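(* There exist absolute constants $c'>0$ and $x_0$ such that for every real $x\geq x_0$ and every non-empty set $A\subset[1,x]$ of primes, writing $|A|=\alpha x(\log x)^{-1}$, we have $$|A+A|\geq c'\,\frac{\log x}{\log (2\alpha^{-1})}\,|A|.$$
   Context: $A+A=\{a_1+a_2: a_1,a_2\in A\}$. Logarithms are natural. *)

theory Defs
  imports
    Complex_Main
    "HOL-Library.Set_Algebras"
    "HOL-Computational_Algebra.Primes"
begin

text \<open>The sumset is the elementwise addition of sets from \<^theory>\<open>HOL-Library.Set_Algebras\<close>.\<close>

end

theory Submission
  imports
    Defs
    "HOL-Computational_Algebra.Squarefree"
    "HOL-Analysis.Harmonic_Numbers"
    "HOL-Real_Asymp.Real_Asymp"
    "HOL-Number_Theory.Cong"
begin

text \<open>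
  Sieve only by the primes in \<open>[z, R]\<close>, where \<open>z\<close> is a large multiple of \<open>(2 / \<alpha>)\<^sup>3\<close> and \<open>R\<close> a small
  power of \<open>x\<close>. The squared Selberg weight is a majorant of the unsieved integers with mean about
  \<open>1 / G\<close>, where \<open>G\<close> has order \<open>log x / log z\<close>; leaving out the small primes costs the factor
  \<open>log z \<asymp> log (2 / \<alpha>)\<close>. Let \<open>T s\<close> be the sum of this majorant at \<open>s - a\<close> over \<open>a \<in> A\<close>.
  The sum of \<open>T\<close> over \<open>A + A\<close> is at least \<open>|A|\<^sup>2\<close>, since \<open>s - a\<close> is an unsieved prime for \<open>|A|\<^sup>2\<close> pairs.
  On the other hand \<open>T\<close> has mean about \<open>|A| / G\<close> and its variance over all \<open>s \<le> 2 x\<close> is tiny: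
  expanding in Ramanujan sums, only moduli all of whose prime factors are at least \<open>z\<close> contribute,
  so that a factor \<open>1 / z\<close> is gained, which outweighs the powers of \<open>1 / \<alpha>\<close> that are lost when
  the differences \<open>a - a'\<close> in a residue class are counted by a Brun-Titchmarsh bound.
  Hence \<open>|A|\<^sup>2\<close> is at most of order \<open>|A + A| |A| / G\<close>.
\<close>

section \<open>The sieve weight and its square\<close>

definition ramanujan :: "nat \<Rightarrow> int \<Rightarrow> real" where
  "ramanujan p n = (if int p dvd n then real p - 1 else -1)"

definition ramanujan_prod :: "nat set \<Rightarrow> int \<Rightarrow> real" where
  "ramanujan_prod D n = (\<Prod>p\<in>D. ramanujan p n)"

text \<open>For \<open>P\<close> consisting of primes, a set \<open>D\<close> stands for the
  squarefree integer \<open>\<Prod>D\<close>. With sets of prime factors, multiplicative functions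
  become products over \<open>D\<close>, and lcm and gcd become union and intersection.\<close>

definition levels :: "nat set \<Rightarrow> nat \<Rightarrow> nat set set" where
  "levels P R = {D. D \<subseteq> P \<and> \<Prod>D \<le> R}"

text \<open>The quantity \<open>G\<close> of the overview: the normalising factor of Selberg's
  sieve, with 1/d in place of the usual 1/phi(d).\<close>

definition sieve_mass :: "nat set \<Rightarrow> nat \<Rightarrow> real" where
  "sieve_mass P R = (\<Sum>D\<in>levels P R. 1 / real (\<Prod>D))"

text \<open>For squarefree \<open>q = \<Prod>D\<close>, \<open>ramanujan_prod D\<close> is the Ramanujan sum \<open>c\<^sub>q\<close>. Selberg's optimal weights
  would have \<open>1 / (p - 1)\<close> in place of \<open>1 / p\<close>; the simpler choice costs only a constant factor.\<close>

definition selberg :: "nat set \<Rightarrow> nat \<Rightarrow> int \<Rightarrow> real" where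
  "selberg P R n = (\<Sum>D\<in>levels P R. \<Prod>p\<in>D. - ramanujan p n / real p)"

section \<open>Closure properties of the families \<open>levels\<close>\<close>

lemma finite_levels [simp]: "finite P \<Longrightarrow> finite (levels P R)"
  by (rule finite_subset[of _ "Pow P"]) (auto simp: levels_def)

lemma levels_finite: "D \<in> levels P R \<Longrightarrow> finite P \<Longrightarrow> finite D"
  by (auto simp: levels_def intro: finite_subset)

lemma prod_primes_pos: "\<forall>p\<in>D. prime p \<Longrightarrow> (\<Prod>D :: nat) > 0"
  by (rule prod_pos) (auto simp: prime_gt_0_nat)

lemma prod_primes_mono:
  assumes "finite E" "D \<subseteq> E" "\<forall>p\<in>E. prime (p::nat)"
  shows "\<Prod>D \<le> \<Prod>E"
  using assms by (intro dvd_imp_le prod_dvd_prod_subset prod_primes_pos) auto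

lemma prod_primes_Un_le:
  assumes "finite D" "finite E" "\<forall>p\<in>D \<union> E. prime (p::nat)"
  shows "\<Prod>(D \<union> E) \<le> \<Prod>D * \<Prod>E"
proof -
  have "\<Prod>(D \<union> E) * \<Prod>(D \<inter> E) = \<Prod>D * \<Prod>E"
    using prod.union_inter[OF assms(1,2), of "\<lambda>x. x"] by simp
  moreover have "\<Prod>(D \<inter> E) > 0"
    by (rule prod_primes_pos) (use assms(3) in auto)
  hence "\<Prod>(D \<inter> E) \<ge> 1" by linarith
  ultimately show ?thesis
    by (metis mult_le_mono2 nat_mult_1_right)
qed

lemma levels_subset:
  assumes "D \<in> levels P R" "E \<subseteq> D" "finite P" "\<forall>p\<in>P. prime p"
  shows "E \<in> levels P R"
proof -
  have "\<Prod>E \<le> \<Prod>D"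
    using assms by (intro prod_primes_mono) (auto simp: levels_def intro: finite_subset)
  with assms show ?thesis by (auto simp: levels_def)
qed

lemma levels_Un:
  assumes "D \<in> levels P R" "E \<in> levels P R" "finite P" "\<forall>p\<in>P. prime p"
  shows "D \<union> E \<in> levels P (R\<^sup>2)"
proof -
  have "\<Prod>(D \<union> E) \<le> \<Prod>D * \<Prod>E"
    using assms by (intro prod_primes_Un_le) (auto simp: levels_def intro: finite_subset)
  also have "\<dots> \<le> R * R" using assms by (intro mult_le_mono) (auto simp: levels_def)
  finally show ?thesis using assms by (auto simp: levels_def power2_eq_square)
qed

lemma empty_in_levels: "R > 0 \<Longrightarrow> {} \<in> levels P R"
  by (auto simp: levels_def)

lemma sieve_mass_ge_1:
  assumes "finite P" "R > 0"
  shows "sieve_mass P R \<ge> 1"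
proof -
  have "(\<Sum>D\<in>{{}}. 1 / real (\<Prod>D)) \<le> sieve_mass P R"
    unfolding sieve_mass_def using assms
    by (intro sum_mono2) (auto simp: empty_in_levels prod_nonneg)
  thus ?thesis by simp
qed

text \<open>Every factor \<open>ramanujan p n\<close> is -1 here, so all terms are positive. Hence
  the square of \<open>selberg\<close> divided by \<open>sieve_mass\<close> is nonnegative
  everywhere and equals 1 on unsieved integers: this is the majorant.\<close>

lemma selberg_rough:
  assumes "\<And>p. p \<in> P \<Longrightarrow> \<not> int p dvd n"
  shows "selberg P R n = sieve_mass P R"
  unfolding selberg_def sieve_mass_def
proof (rule sum.cong[OF refl])
  fix D assume "D \<in> levels P R"
  hence "\<And>p. p \<in> D \<Longrightarrow> \<not> int p dvd n" using assms by (auto simp: levels_def)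
  hence "(\<Prod>p\<in>D. - ramanujan p n / real p) = (\<Prod>p\<in>D. 1 / real p)"
    by (intro prod.cong) (auto simp: ramanujan_def)
  also have "\<dots> = 1 / real (\<Prod>D)" by (simp add: prod_dividef)
  finally show "(\<Prod>p\<in>D. - ramanujan p n / real p) = 1 / real (\<Prod>D)" .
qed

text \<open>A Ramanujan sum c to a prime modulus p satisfies c^2 = (p - 2) c + (p - 1), so products
  of two terms of \<open>selberg\<close> expand into Ramanujan sums again. The bound saves the full
  factor \<open>\<Prod>X\<close> and loses only one factor \<open>sieve_mass P R\<close>, although
  pairs of sets are summed.\<close>

lemma selberg_square_expansion:
  assumes P: "finite P" "\<forall>p\<in>P. prime p"
  obtains w where
    "\<And>n. (selberg P R n)\<^sup>2 = (\<Sum>X\<in>levels P (R\<^sup>2). w X * ramanujan_prod X n)"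
    "\<And>X. X \<in> levels P (R\<^sup>2) \<Longrightarrow> \<bar>w X\<bar> \<le> 4 ^ card X / real (\<Prod>X) * sieve_mass P R"
proof -
  define L where "L = levels P R"
  \<comment> \<open>At a prime of the union, the product of the factors present is \<open>b\<close>
    times the Ramanujan sum plus \<open>a\<close>. In the intersection this is the quadratic
    relation divided by p^2; elsewhere there is one factor and no constant term.\<close>
  define b where "b = (\<lambda>D1 D2 p. if p \<in> D1 \<inter> D2 then (real p - 2) / (real p)\<^sup>2 else - 1 / real p)"
  define a where "a = (\<lambda>D1 D2 p. if p \<in> D1 \<inter> D2 then (real p - 1) / (real p)\<^sup>2 else 0)"
  define t where "t = (\<lambda>D1 D2 X. if X \<subseteq> D1 \<union> D2 then
      (\<Prod>p\<in>X. b D1 D2 p) * (\<Prod>p\<in>(D1 \<union> D2) - X. a D1 D2 p) else 0)"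
  define w where "w = (\<lambda>X. \<Sum>(D1,D2)\<in>L\<times>L. t D1 D2 X)"
  have finL: "finite L" using P by (simp add: L_def)
  have finD: "finite D" and subD: "D \<subseteq> P" if "D \<in> L" for D
    using that P by (auto simp: L_def levels_def intro: finite_subset)
  have p2: "real p \<ge> 2" if "p \<in> P" for p
    using P that prime_ge_2_nat by force
  have pair: "(\<Prod>p\<in>D1. - ramanujan p n / real p) * (\<Prod>p\<in>D2. - ramanujan p n / real p) =
      (\<Sum>X\<in>levels P (R\<^sup>2). t D1 D2 X * ramanujan_prod X n)" if D: "D1 \<in> L" "D2 \<in> L" for D1 D2 n
  proof -
    let ?y = "\<lambda>p. - ramanujan p n / real p"
    let ?U = "D1 \<union> D2"
    have fU: "finite ?U" using D finD by auto
    have "prod ?y D1 = (\<Prod>p\<in>?U. if p \<in> D1 then ?y p else 1)"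
      using fU by (intro prod.mono_neutral_cong_left) auto
    moreover have "prod ?y D2 = (\<Prod>p\<in>?U. if p \<in> D2 then ?y p else 1)"
      using fU by (intro prod.mono_neutral_cong_left) auto
    ultimately have "prod ?y D1 * prod ?y D2 =
        (\<Prod>p\<in>?U. (if p \<in> D1 then ?y p else 1) * (if p \<in> D2 then ?y p else 1))"
      by (simp add: prod.distrib)
    also have "\<dots> = (\<Prod>p\<in>?U. b D1 D2 p * ramanujan p n + a D1 D2 p)"
    proof (rule prod.cong[OF refl])
      fix p assume "p \<in> ?U"
      moreover from this have "real p \<noteq> 0" using p2[of p] subD[OF D(1)] subD[OF D(2)] by fastforce
      ultimately show "(if p \<in> D1 then ?y p else 1) * (if p \<in> D2 then ?y p else 1) =
          b D1 D2 p * ramanujan p n + a D1 D2 p"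
        by (auto simp: b_def a_def ramanujan_def field_simps power2_eq_square)
    qed
    also have "\<dots> = (\<Sum>X\<in>Pow ?U. (\<Prod>p\<in>X. b D1 D2 p * ramanujan p n) * (\<Prod>p\<in>?U - X. a D1 D2 p))"
      by (rule prod_add[OF fU])
    also have "\<dots> = (\<Sum>X\<in>Pow ?U. t D1 D2 X * ramanujan_prod X n)"
      by (intro sum.cong refl) (auto simp: t_def ramanujan_prod_def prod.distrib mult_ac)
    also have "\<dots> = (\<Sum>X\<in>levels P (R\<^sup>2). t D1 D2 X * ramanujan_prod X n)"
    proof (rule sum.mono_neutral_left)
      have "?U \<in> levels P (R\<^sup>2)" using D P by (intro levels_Un) (auto simp: L_def)
      thus "Pow ?U \<subseteq> levels P (R\<^sup>2)" using P levels_subset by blast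
    qed (use P in \<open>auto simp: t_def\<close>)
    finally show ?thesis .
  qed
  show ?thesis
  proof (rule that[of w])
    fix n
    let ?h = "\<lambda>D. \<Prod>p\<in>D. - ramanujan p n / real p"
    have "(selberg P R n)\<^sup>2 = (\<Sum>(D1,D2)\<in>L\<times>L. ?h D1 * ?h D2)"
      by (simp add: selberg_def power2_eq_square L_def sum_product sum.cartesian_product)
    also have "\<dots> = (\<Sum>(D1,D2)\<in>L\<times>L. \<Sum>X\<in>levels P (R\<^sup>2). t D1 D2 X * ramanujan_prod X n)"
      using pair by (intro sum.cong) auto
    also have "\<dots> = (\<Sum>X\<in>levels P (R\<^sup>2). \<Sum>(D1,D2)\<in>L\<times>L. t D1 D2 X * ramanujan_prod X n)"
      unfolding case_prod_unfold by (rule sum.swap)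
    also have "\<dots> = (\<Sum>X\<in>levels P (R\<^sup>2). w X * ramanujan_prod X n)"
      by (simp add: w_def sum_distrib_right case_prod_unfold)
    finally show "(selberg P R n)\<^sup>2 = (\<Sum>X\<in>levels P (R\<^sup>2). w X * ramanujan_prod X n)" .
  next
    fix X assume X: "X \<in> levels P (R\<^sup>2)"
    hence fX: "finite X" "X \<subseteq> P" using P by (auto simp: levels_def intro: finite_subset)
    \<comment> \<open>Only these pairs can contribute: a prime outside \<open>X\<close> enters
      through its constant term \<open>a\<close>, which vanishes unless the prime lies in both
      sets.\<close>
    define T where "T = {(D1,D2) \<in> L \<times> L. X \<subseteq> D1 \<union> D2 \<and> (D1 \<union> D2) - X \<subseteq> D1 \<inter> D2}"
    \<comment> \<open>On \<open>T\<close> the two sets agree outside \<open>X\<close>. A pair is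
      thus determined by its two traces on \<open>X\<close>, at most \<open>4 ^ card X\<close>
      choices, and by one common remainder, over which the reciprocals sum to at most
      \<open>sieve_mass P R\<close>.\<close>
    define \<phi> where "\<phi> = (\<lambda>(D1,D2). ((D1 \<inter> X, D2 \<inter> X), D1 - X))"
    define g where "g = (\<lambda>(y::nat set \<times> nat set, K). 1 / real (\<Prod>X) * (1 / real (\<Prod>K)))"
    have finT: "finite T" using finL by (auto simp: T_def intro: finite_subset[of _ "L\<times>L"])
    have tb: "\<bar>t D1 D2 X\<bar> \<le> (if (D1,D2) \<in> T then g (\<phi> (D1,D2)) else 0)" if D: "(D1,D2) \<in> L \<times> L" for D1 D2
    proof (cases "(D1,D2) \<in> T")
      case True
      hence eq: "(D1 \<union> D2) - X = D1 - X" by (auto simp: T_def)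
      have D12: "D1 \<subseteq> P" "D2 \<subseteq> P" using D subD by auto
      have "\<bar>\<Prod>p\<in>X. b D1 D2 p\<bar> \<le> (\<Prod>p\<in>X. 1 / real p)"
        unfolding abs_prod
      proof (rule prod_mono, safe)
        fix p assume "p \<in> X"
        hence "real p \<ge> 2" using fX p2 by auto
        thus "\<bar>b D1 D2 p\<bar> \<le> 1 / real p"
          by (auto simp: b_def abs_if field_simps power2_eq_square)
      qed auto
      moreover have "\<bar>\<Prod>p\<in>D1 - X. a D1 D2 p\<bar> \<le> (\<Prod>p\<in>D1 - X. 1 / real p)"
        unfolding abs_prod
      proof (rule prod_mono, safe)
        fix p assume "p \<in> D1"
        hence "real p \<ge> 2" using D12 p2 by auto
        thus "\<bar>a D1 D2 p\<bar> \<le> 1 / real p"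
          by (auto simp: a_def abs_if field_simps power2_eq_square)
      qed auto
      ultimately have "\<bar>\<Prod>p\<in>X. b D1 D2 p\<bar> * \<bar>\<Prod>p\<in>D1 - X. a D1 D2 p\<bar> \<le>
          (\<Prod>p\<in>X. 1 / real p) * (\<Prod>p\<in>D1 - X. 1 / real p)"
        by (intro mult_mono) (auto intro: prod_nonneg)
      also have "\<dots> = g (\<phi> (D1,D2))"
        by (simp add: g_def \<phi>_def prod_dividef)
      finally show ?thesis using True by (simp add: t_def T_def eq abs_mult)
    next
      case False
      have "t D1 D2 X = 0"
      proof (cases "X \<subseteq> D1 \<union> D2")
        case True
        with False D obtain p where p: "p \<in> (D1 \<union> D2) - X" "p \<notin> D1 \<inter> D2" by (auto simp: T_def)
        have "finite ((D1 \<union> D2) - X)" using D finD by auto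
        moreover have "a D1 D2 p = 0" using p(2) by (auto simp: a_def)
        ultimately show ?thesis using p(1) unfolding t_def
          by (metis mult_zero_right prod_zero)
      qed (simp add: t_def)
      thus ?thesis using False by simp
    qed
    have inj: "inj_on \<phi> T"
    proof (rule inj_onI, clarify)
      fix D1 D2 E1 E2 assume *: "(D1,D2) \<in> T" "(E1,E2) \<in> T" "\<phi> (D1,D2) = \<phi> (E1,E2)"
      have "D2 - X = D1 - X" "E2 - X = E1 - X" using *(1,2) by (auto simp: T_def)
      moreover have "D1 \<inter> X = E1 \<inter> X" "D2 \<inter> X = E2 \<inter> X" "D1 - X = E1 - X"
        using *(3) by (auto simp: \<phi>_def)
      ultimately show "D1 = E1 \<and> D2 = E2" by blast
    qed
    have "\<bar>w X\<bar> \<le> (\<Sum>(D1,D2)\<in>L\<times>L. \<bar>t D1 D2 X\<bar>)"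
      unfolding w_def case_prod_unfold by (rule sum_abs)
    also have "\<dots> \<le> (\<Sum>d\<in>L\<times>L. if d \<in> T then g (\<phi> d) else 0)"
      by (intro sum_mono, clarify, rule tb, auto)
    also have "\<dots> = (\<Sum>d\<in>T. g (\<phi> d))"
      using finL by (subst sum.If_cases) (auto simp: T_def intro!: sum.cong)
    also have "\<dots> = sum g (\<phi> ` T)" by (simp add: sum.reindex[OF inj])
    also have "\<dots> \<le> sum g ((Pow X \<times> Pow X) \<times> L)"
    proof (rule sum_mono2)
      show "\<phi> ` T \<subseteq> (Pow X \<times> Pow X) \<times> L"
        using levels_subset[OF _ Diff_subset P] by (auto simp: \<phi>_def T_def L_def)
    qed (use finL fX in \<open>auto simp: g_def prod_nonneg\<close>)
    also have "\<dots> = (\<Sum>y\<in>Pow X \<times> Pow X. \<Sum>K\<in>L. 1 / real (\<Prod>X) * (1 / real (\<Prod>K)))"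
      unfolding g_def case_prod_unfold by (simp only: sum.cartesian_product case_prod_unfold)
    also have "\<dots> = real (card (Pow X \<times> Pow X)) * (1 / real (\<Prod>X) * sieve_mass P R)"
      by (simp add: sieve_mass_def L_def sum_distrib_left)
    also have "card (Pow X \<times> Pow X) = 4 ^ card X"
      using fX by (simp add: card_cartesian_product card_Pow flip: power_mult_distrib)
    finally show "\<bar>w X\<bar> \<le> 4 ^ card X / real (\<Prod>X) * sieve_mass P R" by simp
  qed
qed

section \<open>Correlations of Ramanujan sums\<close>

lemma sum_periodic_coprime:
  fixes f g :: "nat \<Rightarrow> real"
  assumes "coprime m k" "m > 0" "k > 0"
    and "\<And>n. f (n mod m) = f n" "\<And>n. g (n mod k) = g n"
  shows "(\<Sum>n<m * k. f n * g n) = (\<Sum>i<m. f i) * (\<Sum>j<k. g j)"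
proof -
  let ?h = "\<lambda>n. (n mod m, n mod k)"
  have inj: "inj_on ?h {..<m * k}"
  proof (rule inj_onI)
    fix x y assume *: "x \<in> {..<m * k}" "y \<in> {..<m * k}" "?h x = ?h y"
    hence "[x = y] (mod m)" "[x = y] (mod k)" by (simp_all add: cong_def)
    hence "[x = y] (mod m * k)" using assms(1) by (intro coprime_cong_mult_nat)
    thus "x = y" using * by (intro cong_less_modulus_unique_nat[of x y "m * k"]) auto
  qed
  have sub: "?h ` {..<m * k} \<subseteq> {..<m} \<times> {..<k}" using assms by auto
  have "card (?h ` {..<m * k}) = card ({..<m} \<times> {..<k})"
    using inj by (simp add: card_image card_cartesian_product)
  hence img: "?h ` {..<m * k} = {..<m} \<times> {..<k}"
    using sub by (intro card_subset_eq) auto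
  have "(\<Sum>i<m. f i) * (\<Sum>j<k. g j) = (\<Sum>(i,j)\<in>{..<m} \<times> {..<k}. f i * g j)"
    by (simp add: sum_product sum.cartesian_product)
  also have "\<dots> = (\<Sum>n<m * k. f (n mod m) * g (n mod k))"
    unfolding img[symmetric] by (subst sum.reindex[OF inj]) simp
  finally show ?thesis using assms by simp
qed

text \<open>Iterated Chinese remainder theorem: over a full period the residues modulo the
  individual primes are independent.\<close>

lemma sum_prod_periodic:
  fixes f :: "nat \<Rightarrow> nat \<Rightarrow> real"
  assumes "finite D" "\<forall>p\<in>D. prime p" "\<And>p n. p \<in> D \<Longrightarrow> f p (n mod p) = f p n"
  shows "(\<Sum>n<\<Prod>D. \<Prod>p\<in>D. f p n) = (\<Prod>p\<in>D. \<Sum>j<p. f p j)"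
  using assms
proof (induction D rule: finite_induct)
  case (insert q D)
  have cop: "coprime q (\<Prod>D)"
    by (rule prod_coprime_right) (use insert in \<open>auto intro!: primes_coprime\<close>)
  have per: "(\<Prod>p\<in>D. f p (n mod \<Prod>D)) = (\<Prod>p\<in>D. f p n)" for n
  proof (rule prod.cong[OF refl])
    fix p assume p: "p \<in> D"
    hence "p dvd \<Prod>D" using insert by (auto intro: dvd_prodI)
    hence "n mod \<Prod>D mod p = n mod p" by (simp add: mod_mod_cancel)
    thus "f p (n mod \<Prod>D) = f p n" using insert.prems(2)[of p] p by (metis insertCI)
  qed
  have "(\<Sum>n<\<Prod>(insert q D). \<Prod>p\<in>insert q D. f p n) = (\<Sum>n<q * \<Prod>D. f q n * (\<Prod>p\<in>D. f p n))"
    using insert by simp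
  also have "\<dots> = (\<Sum>j<q. f q j) * (\<Sum>n<\<Prod>D. \<Prod>p\<in>D. f p n)"
    using insert cop per prod_primes_pos[of D]
    by (intro sum_periodic_coprime) (auto intro: prime_gt_0_nat)
  also have "\<dots> = (\<Prod>p\<in>insert q D. \<Sum>j<p. f p j)"
    using insert by simp
  finally show ?case .
qed simp

lemma sum_periodic_multiple:
  fixes F :: "nat \<Rightarrow> real"
  assumes "\<And>n. F (n mod M) = F n"
  shows "(\<Sum>n<q * M + r. F n) = q * (\<Sum>n<M. F n) + (\<Sum>n<r. F n)"
proof (induction q)
  case (Suc q)
  have shift: "F (n + M) = F n" for n using assms by (metis mod_add_self2)
  have "(\<Sum>n<Suc q * M + r. F n) = (\<Sum>n<M. F n) + (\<Sum>n<q * M + r. F (n + M))"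
    using sum.atLeastLessThan_concat[of 0 M "M + (q * M + r)" F]
      sum.shift_bounds_nat_ivl[of F 0 M "q * M + r"]
    by (simp add: add_ac atLeast0LessThan)
  thus ?case using Suc by (simp add: shift algebra_simps)
qed simp

text \<open>Full periods contribute exactly their mean. In the last, incomplete period both the sum
  and its predicted value are at most \<open>M * B\<close>, whence the factor 2.\<close>

lemma sum_periodic_interval:
  fixes F :: "nat \<Rightarrow> real"
  assumes "M > 0" "\<And>n. F (n mod M) = F n" "\<And>n. \<bar>F n\<bar> \<le> B" "(\<Sum>n<M. F n) = M * \<mu>"
  shows "\<bar>(\<Sum>n<N. F n) - N * \<mu>\<bar> \<le> 2 * M * B"
proof -
  define r where "r = N mod M"
  have r: "r \<le> M" using assms by (simp add: r_def less_imp_le)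
  have B: "B \<ge> 0" using assms(3)[of 0] by linarith
  have bd: "\<bar>\<Sum>n<k. F n\<bar> \<le> k * B" for k
  proof -
    have "\<bar>\<Sum>n<k. F n\<bar> \<le> (\<Sum>n<k. B)"
      by (rule order.trans[OF sum_abs sum_mono]) (rule assms(3))
    thus ?thesis by simp
  qed
  have "\<bar>M * \<mu>\<bar> \<le> M * B" using bd[of M] assms(4) by simp
  hence mu: "\<bar>\<mu>\<bar> \<le> B" using assms(1) by (simp add: abs_mult)
  have N: "N = N div M * M + r" by (simp add: r_def)
  have "(\<Sum>n<N. F n) = (N div M) * (M * \<mu>) + (\<Sum>n<r. F n)"
    using sum_periodic_multiple[of F M "N div M" r] assms(2,4) N by simp
  moreover have "real N * \<mu> = (N div M) * (M * \<mu>) + r * \<mu>"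
    by (subst (1) N) (simp add: algebra_simps)
  ultimately have "(\<Sum>n<N. F n) - N * \<mu> = (\<Sum>n<r. F n) - r * \<mu>" by simp
  also have "\<bar>\<dots>\<bar> \<le> r * B + r * B"
  proof -
    have "\<bar>r * \<mu>\<bar> \<le> r * B" using mu by (simp add: abs_mult mult_left_mono)
    thus ?thesis using bd[of r] by linarith
  qed
  also have "\<dots> \<le> M * B + M * B" using r B by (intro add_mono mult_right_mono) auto
  finally show ?thesis by (simp add: algebra_simps)
qed

section \<open>Orthogonality of Ramanujan sums\<close>

lemma ramanujan_cong: "int p dvd m - n \<Longrightarrow> ramanujan p m = ramanujan p n"
proof -
  assume "int p dvd m - n"
  hence "int p dvd m \<longleftrightarrow> int p dvd n"
    by (metis diff_add_cancel dvd_add_right_iff)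
  thus ?thesis by (simp add: ramanujan_def)
qed

lemma abs_ramanujan_le: "p > 0 \<Longrightarrow> \<bar>ramanujan p n\<bar> \<le> real p"
  by (auto simp: ramanujan_def)

lemma abs_ramanujan_prod_le: "\<forall>p\<in>D. prime p \<Longrightarrow> \<bar>ramanujan_prod D n\<bar> \<le> real (\<Prod>D)"
  unfolding ramanujan_prod_def abs_prod of_nat_prod
  by (intro prod_mono) (auto intro: abs_ramanujan_le prime_gt_0_nat)

lemma card_residue_solutions:
  assumes "p > 0" 
  shows "card {j. j < p \<and> int p dvd int j - a} = 1"
proof -
  have "{j. j < p \<and> int p dvd int j - a} = {nat (a mod int p)}"
  proof safe
    fix j assume "j < p" "int p dvd int j - a"
    hence "int j mod int p = a mod int p" by (metis mod_eq_dvd_iff)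
    moreover have "int j mod int p = int j" using \<open>j < p\<close> by simp
    ultimately show "j = nat (a mod int p)" by (metis nat_int)
  next
    show "nat (a mod int p) < p" using assms by (simp add: nat_less_iff)
    show "int p dvd int (nat (a mod int p)) - a" using assms by (simp add: mod_eq_dvd_iff[symmetric])
  qed
  thus ?thesis by simp
qed

text \<open>The values \<open>r + g * int j\<close> run through all residues modulo
  \<open>p\<close>, so \<open>p - 1\<close> is taken once and -1 is taken \<open>p - 1\<close>
  times.\<close>

lemma sum_ramanujan_linear:
  assumes "prime p" "coprime (int p) g"
  shows "(\<Sum>j<p. ramanujan p (r + g * int j)) = 0"
proof -
  have p: "p > 0" using assms by (simp add: prime_gt_0_nat)
  obtain h where h: "[g * h = 1] (mod int p)"
    using cong_solve_coprime_int[of g "int p"] assms by (auto simp: coprime_commute)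
  have iff: "int p dvd r + g * int j \<longleftrightarrow> int p dvd int j - (- r * h)" for j
  proof
    assume "int p dvd r + g * int j"
    hence "int p dvd h * (r + g * int j) - int j * (g * h - 1)"
      using h by (intro dvd_diff[OF dvd_mult dvd_mult]) (auto simp: cong_iff_dvd_diff)
    thus "int p dvd int j - (- r * h)" by (simp add: algebra_simps)
  next
    assume "int p dvd int j - (- r * h)"
    hence "int p dvd g * (int j - (- r * h)) - r * (g * h - 1)"
      using h by (intro dvd_diff[OF dvd_mult dvd_mult]) (auto simp: cong_iff_dvd_diff)
    thus "int p dvd r + g * int j" by (simp add: algebra_simps)
  qed
  have "(\<Sum>j<p. ramanujan p (r + g * int j)) =
      (\<Sum>j<p. (if int p dvd int j - (- r * h) then real p else 0) - 1)"
    by (intro sum.cong refl) (simp only: ramanujan_def iff, simp)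
  also have "\<dots> = real p * card {j. j < p \<and> int p dvd int j - (- r * h)} - p"
    by (simp add: sum_subtractf sum.If_cases lessThan_def Int_def)
  finally show ?thesis using card_residue_solutions[OF p, of "- r * h"] by simp
qed

text \<open>The first factor is \<open>p\<close> times the indicator of j congruent to a, minus 1.
  The constant averages out by \<open>sum_ramanujan_linear\<close>; the indicator substitutes a for
  j in the second factor.\<close>

lemma sum_ramanujan_mult:
  assumes "prime p"
  shows "(\<Sum>j<p. ramanujan p (int j - a) * ramanujan p (int j - b)) = p * ramanujan p (a - b)"
proof -
  have p: "p > 0" using assms by (simp add: prime_gt_0_nat)
  have 0: "(\<Sum>j<p. ramanujan p (int j - x)) = 0" for x
    using sum_ramanujan_linear[of p 1 "-x"] assms by (simp add: algebra_simps)
  have e: "ramanujan p (int j - a) = (if int p dvd int j - a then real p else 0) - 1" for j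
    by (simp add: ramanujan_def)
  have "(\<Sum>j<p. ramanujan p (int j - a) * ramanujan p (int j - b)) =
     (\<Sum>j<p. (if int p dvd int j - a then real p else 0) * ramanujan p (int j - b)) -
     (\<Sum>j<p. ramanujan p (int j - b))"
    unfolding e by (simp add: sum_subtractf algebra_simps)
  also have "\<dots> = (\<Sum>j<p. (if int p dvd int j - a then real p else 0) * ramanujan p (a - b))"
    unfolding 0 by (simp, intro sum.cong refl) (auto intro!: ramanujan_cong)
  also have "\<dots> = real p * card {j. j < p \<and> int p dvd int j - a} * ramanujan p (a - b)"
    by (simp add: sum_distrib_right[symmetric] sum.If_cases lessThan_def Int_def)
  finally show ?thesis using card_residue_solutions[OF p] by simp
qed

lemma ramanujan_mod:
  assumes "p dvd M"
  shows "ramanujan p (r + g * int (n mod M)) = ramanujan p (r + g * int n)"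
proof (rule ramanujan_cong)
  have "int p dvd int (n mod M) - int n"
    using assms by (metis dvd_trans int_dvd_int_iff mod_eq_dvd_iff mod_mod_trivial of_nat_mod)
  hence "int p dvd g * (int (n mod M) - int n)" by (rule dvd_mult)
  thus "int p dvd r + g * int (n mod M) - (r + g * int n)" by (simp add: algebra_simps)
qed

text \<open>The step \<open>g\<close> is invertible modulo each prime of \<open>D\<close>, so the
  mean over a period is a product of zeros. Only the error of an incomplete period remains.\<close>

lemma sum_ramanujan_prod_progression:
  assumes "finite D" "\<forall>p\<in>D. prime p \<and> coprime (int p) g" "D \<noteq> {}"
  shows "\<bar>\<Sum>n<N. ramanujan_prod D (r + g * int n)\<bar> \<le> 2 * (real (\<Prod>D))\<^sup>2"
proof -
  have "\<bar>(\<Sum>n<N. ramanujan_prod D (r + g * int n)) - real N * 0\<bar> \<le> 2 * real (\<Prod>D) * real (\<Prod>D)"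
  proof (rule sum_periodic_interval)
    show "\<Prod>D > 0" using assms by (intro prod_primes_pos) auto
    show "ramanujan_prod D (r + g * int (n mod \<Prod>D)) = ramanujan_prod D (r + g * int n)" for n
      unfolding ramanujan_prod_def using assms
      by (intro prod.cong refl ramanujan_mod) (auto intro: dvd_prodI)
    show "\<bar>ramanujan_prod D (r + g * int n)\<bar> \<le> real (\<Prod>D)" for n
      using assms by (intro abs_ramanujan_prod_le) auto
    have "(\<Sum>n<\<Prod>D. ramanujan_prod D (r + g * int n)) = (\<Prod>p\<in>D. \<Sum>j<p. ramanujan p (r + g * int j))"
      unfolding ramanujan_prod_def using assms
      by (intro sum_prod_periodic) (auto intro!: ramanujan_mod)
    also have "\<dots> = (\<Prod>p\<in>D. 0)"
      using assms by (intro prod.cong refl sum_ramanujan_linear) auto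
    also have "\<dots> = 0" using assms by (auto simp: card_gt_0_iff)
    finally show "(\<Sum>n<\<Prod>D. ramanujan_prod D (r + g * int n)) = real (\<Prod>D) * 0" by simp
  qed
  thus ?thesis by (simp add: power2_eq_square)
qed

text \<open>A prime in exactly one of the two sets has mean zero and kills the main term. If
  \<open>D = E\<close>, each prime gives \<open>p * ramanujan p (a - b)\<close>, and the factors
  \<open>p\<close> make up the length of the period. The error comes from an incomplete period,
  whose length is at most \<open>\<Prod>D * \<Prod>E\<close>.\<close>

lemma ramanujan_prod_correlation:
  assumes "finite D" "finite E" "\<forall>p\<in>D \<union> E. prime p"
  shows "\<bar>(\<Sum>n<N. ramanujan_prod D (int n - a) * ramanujan_prod E (int n - b)) -
      real N * (if D = E then ramanujan_prod D (a - b) else 0)\<bar> \<le> 2 * (real (\<Prod>D) * real (\<Prod>E))\<^sup>2"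
    (is "\<bar>?S - real N * ?\<mu>\<bar> \<le> _")
proof -
  let ?U = "D \<union> E" and ?B = "real (\<Prod>D) * real (\<Prod>E)"
  let ?F = "\<lambda>n::nat. ramanujan_prod D (int n - a) * ramanujan_prod E (int n - b)"
  define f where "f = (\<lambda>p (n::nat). (if p \<in> D then ramanujan p (int n - a) else 1) *
      (if p \<in> E then ramanujan p (int n - b) else 1))"
  have fU: "finite ?U" using assms by auto
  have F: "?F n = (\<Prod>p\<in>?U. f p n)" for n
  proof -
    have "ramanujan_prod D (int n - a) = (\<Prod>p\<in>?U. if p \<in> D then ramanujan p (int n - a) else 1)"
      unfolding ramanujan_prod_def using fU by (intro prod.mono_neutral_cong_left) auto
    moreover have "ramanujan_prod E (int n - b) = (\<Prod>p\<in>?U. if p \<in> E then ramanujan p (int n - b) else 1)"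
      unfolding ramanujan_prod_def using fU by (intro prod.mono_neutral_cong_left) auto
    ultimately show ?thesis by (simp add: f_def prod.distrib)
  qed
  have rmod: "ramanujan p (int (n mod M) - x) = ramanujan p (int n - x)" if "p dvd M" for p n M x
    using ramanujan_mod[OF that, of "-x" 1 n] by (simp add: algebra_simps)
  have fmod: "f p (n mod M) = f p n" if "p dvd M" for p n M
    using rmod[OF that] by (simp add: f_def)
  have "\<bar>(\<Sum>n<N. ?F n) - real N * ?\<mu>\<bar> \<le> 2 * real (\<Prod>?U) * ?B"
  proof (rule sum_periodic_interval)
    show "\<Prod>?U > 0" using assms by (intro prod_primes_pos) auto
    show "?F (n mod \<Prod>?U) = ?F n" for n
      unfolding F using fU by (intro prod.cong refl fmod) (auto intro: dvd_prodI)
    show "\<bar>?F n\<bar> \<le> ?B" for n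
      unfolding abs_mult using assms
      by (intro mult_mono abs_ramanujan_prod_le of_nat_0_le_iff abs_ge_zero) auto
    have "(\<Sum>n<\<Prod>?U. ?F n) = (\<Prod>p\<in>?U. \<Sum>j<p. f p j)"
      unfolding F using assms by (intro sum_prod_periodic) (auto intro!: fmod)
    also have "\<dots> = real (\<Prod>?U) * ?\<mu>"
    proof (cases "D = E")
      case True
      have "(\<Sum>j<p. f p j) = real p * ramanujan p (a - b)" if "p \<in> D" for p
        using that assms True sum_ramanujan_mult[of p a b] by (simp add: f_def)
      hence "(\<Prod>p\<in>D. \<Sum>j<p. f p j) = (\<Prod>p\<in>D. real p * ramanujan p (a - b))"
        by (intro prod.cong) auto
      thus ?thesis using True by (simp add: prod.distrib ramanujan_prod_def)
    next
      case False
      have 0: "(\<Sum>j<p. ramanujan p (int j - x)) = 0" if "p \<in> ?U" for p x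
        using sum_ramanujan_linear[of p 1 "-x"] assms that by (simp add: algebra_simps)
      from False obtain p where p: "p \<in> ?U" "p \<notin> D \<or> p \<notin> E" by blast
      hence "(\<Sum>j<p. f p j) = 0" using 0[OF p(1)] by (auto simp: f_def)
      hence "(\<Prod>p\<in>?U. \<Sum>j<p. f p j) = 0" using p(1) fU by (intro prod_zero) auto
      thus ?thesis using False by simp
    qed
    finally show "(\<Sum>n<\<Prod>?U. ?F n) = real (\<Prod>?U) * ?\<mu>" .
  qed
  also have "2 * real (\<Prod>?U) * ?B \<le> 2 * ?B * ?B"
  proof (intro mult_right_mono mult_left_mono)
    have "\<Prod>?U \<le> \<Prod>D * \<Prod>E" using assms by (intro prod_primes_Un_le) auto
    thus "real (\<Prod>?U) \<le> ?B" by (metis of_nat_le_iff of_nat_mult)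
  qed (auto simp: prod_nonneg)
  finally show ?thesis by (simp add: power2_eq_square)
qed

section \<open>Differences in residue classes\<close>

lemma prod_one_plus_inverse_subsets:
  assumes "finite F"
  shows "(\<Sum>X\<in>Pow F. 1 / real (\<Prod>X)) = (\<Prod>p\<in>F. 1 + 1 / real p)"
proof -
  have "(\<Prod>p\<in>F. 1 / real p + 1) = (\<Sum>X\<in>Pow F. (\<Prod>p\<in>X. 1 / real p) * (\<Prod>p\<in>F - X. 1))"
    by (rule prod_add[OF assms])
  thus ?thesis by (simp add: prod_dividef add.commute)
qed

text \<open>A set is determined by its parts inside and outside \<open>F\<close>, and the outer part
  still has product at most \<open>R\<close>. Dropping the size condition on the inner part makes
  the double sum factorise.\<close>

lemma sieve_mass_le_prod_Diff:
  assumes P: "finite P" "\<forall>p\<in>P. prime p" and F: "finite F"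
  shows "sieve_mass P R \<le> (\<Prod>p\<in>F. 1 + 1 / real p) * sieve_mass (P - F) R"
proof -
  define \<phi> where "\<phi> = (\<lambda>D::nat set. (D \<inter> F, D - F))"
  define g where "g = (\<lambda>(X::nat set, Y::nat set). 1 / real (\<Prod>X) * (1 / real (\<Prod>Y)))"
  have "sieve_mass P R = (\<Sum>D\<in>levels P R. g (\<phi> D))"
    unfolding sieve_mass_def
  proof (rule sum.cong[OF refl])
    fix D assume "D \<in> levels P R"
    hence "finite D" using P levels_finite by auto
    hence "\<Prod>(D \<inter> F) * \<Prod>(D - F) = \<Prod>D"
      using prod.Int_Diff[of D "\<lambda>x. x" F] by simp
    thus "1 / real (\<Prod>D) = g (\<phi> D)" 
      unfolding g_def \<phi>_def case_prod_conv by (metis mult_1 of_nat_mult times_divide_times_eq)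
  qed
  also have "\<dots> = sum g (\<phi> ` levels P R)"
    by (subst sum.reindex) (auto simp: \<phi>_def intro!: inj_onI)
  also have "\<dots> \<le> sum g (Pow F \<times> levels (P - F) R)"
  proof (rule sum_mono2)
    have "D - F \<in> levels (P - F) R" if "D \<in> levels P R" for D
      using levels_subset[OF that _ P, of "D - F"] that by (auto simp: levels_def)
    thus "\<phi> ` levels P R \<subseteq> Pow F \<times> levels (P - F) R" by (auto simp: \<phi>_def)
  qed (use P F in \<open>auto simp: g_def prod_nonneg\<close>)
  also have "\<dots> = (\<Sum>X\<in>Pow F. 1 / real (\<Prod>X)) * sieve_mass (P - F) R"
    unfolding g_def sieve_mass_def sum_product sum.cartesian_product by simp
  finally show ?thesis using prod_one_plus_inverse_subsets[OF F] by simp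
qed

text \<open>A crude form, uniform in the size of the primes. It is applied with \<open>F\<close> the
  prime factors of a modulus, where a power of 2 is harmless against the reciprocal squares that
  appear in the variance.\<close>

lemma sieve_mass_le_power_Diff:
  assumes P: "finite P" "\<forall>p\<in>P. prime p" and F: "F \<subseteq> P" and "R > 0"
  shows "sieve_mass P R \<le> 2 ^ card F * sieve_mass (P - F) R"
proof -
  have fF: "finite F" using P F finite_subset by auto
  have "(\<Prod>p\<in>F. 1 + 1 / real p) \<le> (\<Prod>p\<in>F. 2)"
  proof (rule prod_mono, safe)
    fix p assume "p \<in> F"
    hence "real p \<ge> 1" using P F by (metis Suc_leI of_nat_1 of_nat_le_iff One_nat_def prime_gt_0_nat subsetD)
    thus "1 + 1 / real p \<le> 2" by (simp add: field_simps)
  qed auto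
  moreover have "sieve_mass (P - F) R \<ge> 0" using sieve_mass_ge_1[of "P - F" R] P assms(4) by simp
  ultimately show ?thesis
    using sieve_mass_le_prod_Diff[OF P fF, of R] by (simp add: mult_right_mono order.trans)
qed

section \<open>Sets of primes as squarefree integers\<close>

lemma inj_on_prod_primes: "inj_on (\<lambda>D. \<Prod>D) {D. finite D \<and> (\<forall>p\<in>D. prime (p::nat))}"
proof (rule inj_onI)
  have sub: "D \<subseteq> E" if "finite D" "finite E" "\<forall>p\<in>D. prime p" "\<forall>p\<in>E. prime (p::nat)" "\<Prod>D = \<Prod>E" for D E
  proof
    fix p assume p: "p \<in> D"
    hence "p dvd \<Prod>E" using that by (metis dvd_prodI)
    moreover have "prime p" using p that by auto
    ultimately obtain q where "q \<in> E" "p dvd q"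
      using \<open>finite E\<close> prime_dvd_prod_iff[of E p "\<lambda>x. x"] by auto
    thus "p \<in> E" using that p primes_dvd_imp_eq by metis
  qed
  fix D E :: "nat set"
  assume "D \<in> {D. finite D \<and> (\<forall>p\<in>D. prime p)}" "E \<in> {D. finite D \<and> (\<forall>p\<in>D. prime p)}" "\<Prod>D = \<Prod>E"
  thus "D = E" using sub[of D E] sub[of E D] by auto
qed

lemma prod_primes_dvd_int:
  assumes "finite F" "\<forall>p\<in>F. prime p \<and> int p dvd n"
  shows "int (\<Prod>F) dvd n"
  using assms
proof (induction F rule: finite_induct)
  case (insert q F)
  have "coprime q (\<Prod>F)"
    by (rule prod_coprime_right) (use insert in \<open>auto intro!: primes_coprime\<close>)
  hence "int q * int (\<Prod>F) dvd n"
    using insert by (intro divides_mult) (auto simp del: of_nat_prod)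
  thus ?case using insert by simp
qed simp

lemma card_levels_le:
  assumes P: "finite P" "\<forall>p\<in>P. prime p"
  shows "card (levels P R) \<le> R"
proof -
  have "card (levels P R) \<le> card {1..R}"
  proof (rule card_inj_on_le)
    show "inj_on (\<lambda>D. \<Prod>D) (levels P R)"
      by (rule inj_on_subset[OF inj_on_prod_primes])
         (use P in \<open>auto simp: levels_def intro: finite_subset\<close>)
    show "(\<lambda>D. \<Prod>D) ` levels P R \<subseteq> {1..R}"
    proof safe
      fix D assume "D \<in> levels P R"
      moreover from this have "\<Prod>D > 0" using P by (intro prod_primes_pos) (auto simp: levels_def)
      ultimately show "\<Prod>D \<in> {1..R}" by (simp add: levels_def Suc_le_eq)
    qed
  qed auto
  thus ?thesis by simp
qed

text \<open>Absorbs the factor \<open>4 ^ card X\<close> of \<open>selberg_square_expansion\<close>,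
  so that every coefficient there is at most \<open>sieve_mass P R\<close>.\<close>

lemma power4_card_le_prod:
  assumes "\<forall>p\<in>D. p \<ge> (4::nat)"
  shows "4 ^ card D \<le> real (\<Prod>D)"
proof -
  have "(\<Prod>p\<in>D. 4) \<le> (\<Prod>p\<in>D. real p)" using assms by (intro prod_mono) auto
  thus ?thesis by simp
qed

text \<open>A Brun-Titchmarsh bound: the squared weight, summed over the whole progression, counts
  each element of \<open>X\<close> with weight G^2. No sieving prime divides the step, so only the
  empty set has a main term, at most G times the length. Each of the remaining sets, at most R^2 in
  number, contributes at most 2 G R^4.\<close>

lemma rough_progression_count:
  assumes P: "finite P" "\<forall>p\<in>P. prime p" "\<forall>p\<in>P. p \<ge> 4" and R: "R > 0"
    and g: "g > 0" "\<forall>p\<in>P. coprime p g"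
    and X: "\<And>a. a \<in> X \<Longrightarrow> a \<le> x \<and> a mod g = r" "\<And>a p. a \<in> X \<Longrightarrow> p \<in> P \<Longrightarrow> \<not> p dvd a"
  shows "real (card X) \<le> (real x / real g + 1 + 2 * real R ^ 6) / sieve_mass P R"
proof -
  define G where "G = sieve_mass P R"
  define L where "L = levels P (R\<^sup>2)"
  have G: "G \<ge> 1" using P R sieve_mass_ge_1 by (simp add: G_def)
  obtain w where w: "\<And>n. (selberg P R n)\<^sup>2 = (\<Sum>D\<in>L. w D * ramanujan_prod D n)"
    "\<And>D. D \<in> L \<Longrightarrow> \<bar>w D\<bar> \<le> 4 ^ card D / real (\<Prod>D) * G"
    using selberg_square_expansion[OF P(1,2), of R, folded L_def G_def] by blast
  have finL: "finite L" using P by (simp add: L_def)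
  have D: "finite D" "D \<subseteq> P" "\<Prod>D \<le> R\<^sup>2" "\<Prod>D > 0" if "D \<in> L" for D
  proof -
    show "finite D" "D \<subseteq> P" "\<Prod>D \<le> R\<^sup>2" 
      using that P finite_subset by (auto simp: L_def levels_def)
    thus "\<Prod>D > 0" using P by (intro prod_primes_pos) auto
  qed
  \<comment> \<open>The elements are \<open>r + g * k\<close> with k between 0 and
    \<open>x div g\<close>.\<close>
  define N where "N = x div g + 1"
  let ?h = "\<lambda>k. selberg P R (int r + int g * int k)"
  have wb: "\<bar>w D\<bar> \<le> G" if "D \<in> L" for D
  proof -
    have "4 ^ card D / real (\<Prod>D) \<le> 1"
      using power4_card_le_prod[of D] D[OF that] P
      by (subst divide_le_eq_1_pos) (auto simp del: of_nat_prod)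
    hence "4 ^ card D / real (\<Prod>D) * G \<le> 1 * G" using G by (intro mult_right_mono) auto
    thus ?thesis using w(2)[OF that] by simp
  qed
  have "X \<subseteq> {..x}" using X by auto
  hence finX: "finite X" using finite_subset by blast
  have inj: "inj_on (\<lambda>a. a div g) X"
    using X(1) by (intro inj_onI) (metis div_mult_mod_eq)
  have "real (card X) * G\<^sup>2 = (\<Sum>k\<in>(\<lambda>a. a div g) ` X. G\<^sup>2)"
    by (simp add: card_image inj)
  also have "\<dots> = (\<Sum>k\<in>(\<lambda>a. a div g) ` X. (?h k)\<^sup>2)"
  proof (rule sum.cong[OF refl])
    fix k assume "k \<in> (\<lambda>a. a div g) ` X"
    then obtain a where a: "a \<in> X" "k = a div g" by auto
    hence "r + g * k = a" using X(1) by (metis mod_mult_div_eq)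
    hence "int r + int g * int k = int a" by (metis of_nat_add of_nat_mult)
    thus "G\<^sup>2 = (?h k)\<^sup>2" using selberg_rough[of P "int a" R] X(2)[OF a(1)] by (simp add: G_def)
  qed
  also have "\<dots> \<le> (\<Sum>k<N. (?h k)\<^sup>2)"
  proof (rule sum_mono2)
    show "(\<lambda>a. a div g) ` X \<subseteq> {..<N}"
      using X(1) by (auto simp: N_def less_Suc_eq_le intro!: div_le_mono)
  qed auto
  also have "\<dots> = (\<Sum>D\<in>L. w D * (\<Sum>k<N. ramanujan_prod D (int r + int g * int k)))"
    unfolding w(1) by (subst sum.swap) (simp add: sum_distrib_left)
  also have "\<dots> \<le> (\<Sum>D\<in>L. (if D = {} then G * N else 0) + G * (2 * real R ^ 4))"
  proof (rule sum_mono)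
    fix D assume DL: "D \<in> L"
    show "w D * (\<Sum>k<N. ramanujan_prod D (int r + int g * int k)) \<le>
        (if D = {} then G * N else 0) + G * (2 * real R ^ 4)"
    proof (cases "D = {}")
      case True
      have "w D * real N \<le> G * real N"
        using wb[OF DL] by (intro mult_right_mono) auto
      moreover have "G * (2 * real R ^ 4) \<ge> 0" using G by simp
      ultimately show ?thesis using True by (simp add: ramanujan_prod_def)
    next
      case False
      have "\<bar>\<Sum>k<N. ramanujan_prod D (int r + int g * int k)\<bar> \<le> 2 * (real (\<Prod>D))\<^sup>2"
        using False D[OF DL] P g by (intro sum_ramanujan_prod_progression) auto
      also have "\<dots> \<le> 2 * (real (R\<^sup>2))\<^sup>2"
        using D(3)[OF DL] by (intro mult_left_mono power_mono) (auto simp del: of_nat_prod)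
      also have "\<dots> = 2 * real R ^ 4" by simp
      finally have "\<bar>w D\<bar> * \<bar>\<Sum>k<N. ramanujan_prod D (int r + int g * int k)\<bar> \<le> G * (2 * real R ^ 4)"
        using wb[OF DL] G by (intro mult_mono) auto
      thus ?thesis using False by (simp add: abs_mult[symmetric])
    qed
  qed
  also have "\<dots> \<le> G * N + real (card L) * (G * (2 * real R ^ 4))"
    using G finL by (simp add: sum.distrib sum.delta' sum.delta)
  also have "\<dots> \<le> G * N + real (R\<^sup>2) * (G * (2 * real R ^ 4))"
    using card_levels_le[OF P(1,2), of "R\<^sup>2"] G
    by (intro add_left_mono mult_right_mono) (auto simp: L_def)
  also have "\<dots> = G * (real N + 2 * real R ^ 6)" by (simp add: algebra_simps power2_eq_square numeral_eq_Suc)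
  finally have "real (card X) * G\<^sup>2 \<le> G * (real N + 2 * real R ^ 6)" .
  hence "G * (real (card X) * G) \<le> G * (real N + 2 * real R ^ 6)"
    by (simp only: power2_eq_square mult_ac)
  hence "real (card X) * G \<le> real N + 2 * real R ^ 6"
    using G by (simp only: mult_le_cancel_left_pos)
  also have "real N \<le> real x / real g + 1"
    using of_nat_div_le_of_nat[of x g, where ?'a=real] by (simp add: N_def)
  finally show ?thesis using G by (simp add: G_def field_simps)
qed

text \<open>The bound for the inner sum is uniform in a. Expanding the product over \<open>D\<close>
  into subsets \<open>F\<close> leads to counting the b congruent to a modulo
  \<open>\<Prod>F\<close>, with weight \<open>\<Prod>F\<close>; this weight cancels the density of
  the residue class. The losses \<open>2 ^ card F\<close> add up to
  \<open>3 ^ card D\<close>.\<close>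

lemma sum_abs_ramanujan_prod_differences:
  assumes P: "finite P" "\<forall>p\<in>P. prime p" "\<forall>p\<in>P. p \<ge> 4" and R: "R > 0" "3 * R ^ 8 \<le> x"
    and A: "A \<subseteq> {..x}" "\<And>a p. a \<in> A \<Longrightarrow> p \<in> P \<Longrightarrow> \<not> p dvd a"
    and D: "D \<in> levels P (R\<^sup>2)"
  shows "(\<Sum>a\<in>A. \<Sum>b\<in>A. \<bar>ramanujan_prod D (int a - int b)\<bar>) \<le>
    real (card A) * 3 ^ card D * (2 * real x / sieve_mass P R)"
proof -
  define G where "G = sieve_mass P R"
  have G: "G \<ge> 1" using P R sieve_mass_ge_1 by (simp add: G_def)
  have finA: "finite A" using A finite_subset by blast
  have finD: "finite D" and DP: "D \<subseteq> P" using D P by (auto simp: levels_def intro: finite_subset)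
  have "(\<Sum>b\<in>A. \<bar>ramanujan_prod D (int a - int b)\<bar>) \<le> 3 ^ card D * (2 * real x / G)" for a
  proof -
    let ?c = "\<lambda>p b. if int p dvd int a - int b then real p else 0"
    have "(\<Sum>b\<in>A. \<bar>ramanujan_prod D (int a - int b)\<bar>) \<le> (\<Sum>b\<in>A. \<Prod>p\<in>D. ?c p b + 1)"
      unfolding ramanujan_prod_def abs_prod
      by (intro sum_mono prod_mono) (auto simp: ramanujan_def)
    also have "\<dots> = (\<Sum>b\<in>A. \<Sum>F\<in>Pow D. \<Prod>p\<in>F. ?c p b)"
      by (simp add: prod_add[OF finD])
    also have "\<dots> = (\<Sum>F\<in>Pow D. \<Sum>b\<in>A. \<Prod>p\<in>F. ?c p b)"
      by (rule sum.swap)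
    also have "\<dots> \<le> (\<Sum>F\<in>Pow D. 2 ^ card F * (2 * real x / G))"
    proof (rule sum_mono)
      fix F assume "F \<in> Pow D"
      hence F: "F \<in> levels P (R\<^sup>2)" using levels_subset D P by auto
      hence finF: "finite F" and FP: "F \<subseteq> P" and FR: "\<Prod>F \<le> R\<^sup>2"
        using P by (auto simp: levels_def intro: finite_subset)
      have Fpos: "\<Prod>F > 0" using P FP by (intro prod_primes_pos) auto
      define X where "X = {b\<in>A. \<forall>p\<in>F. int p dvd int a - int b}"
      \<comment> \<open>The primes of \<open>F\<close> divide the modulus of the progression, so
        they must be left out when sieving it.\<close>
      define G' where "G' = sieve_mass (P - F) R"
      have G': "G' \<ge> 1" using P R sieve_mass_ge_1 by (simp add: G'_def)
      have GG': "G \<le> 2 ^ card F * G'"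
        unfolding G_def G'_def using P FP R by (intro sieve_mass_le_power_Diff) auto
      have "real (card X) \<le> (real x / real (\<Prod>F) + 1 + 2 * real R ^ 6) / G'"
        unfolding G'_def
      proof (rule rough_progression_count)
        show "\<forall>p\<in>P - F. coprime p (\<Prod>F)"
          using P FP by (auto intro!: prod_coprime_right primes_coprime)
        fix b assume b: "b \<in> X"
        have "int (\<Prod>F) dvd int a - int b"
          using b P FP finF by (intro prod_primes_dvd_int) (auto simp: X_def)
        hence "int a mod int (\<Prod>F) = int b mod int (\<Prod>F)"
          by (metis mod_eq_dvd_iff)
        hence "b mod \<Prod>F = a mod \<Prod>F" by (metis of_nat_eq_iff of_nat_mod)
        thus "b \<le> x \<and> b mod \<Prod>F = a mod \<Prod>F" using b A(1) by (auto simp: X_def)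
      qed (use P R A Fpos in \<open>auto simp: X_def\<close>)
      hence "real (\<Prod>F) * real (card X) \<le> real (\<Prod>F) * ((real x / real (\<Prod>F) + 1 + 2 * real R ^ 6) / G')"
        by (intro mult_left_mono) (auto simp del: of_nat_prod)
      also have "\<dots> = (real x + real (\<Prod>F) * (1 + 2 * real R ^ 6)) / G'"
      proof -
        have "y * ((u / y + 1 + c) / G') = (u + y * (1 + c)) / G'" if "y \<noteq> 0" for y u c :: real
          using that by (simp add: distrib_left add.assoc)
        thus ?thesis using Fpos by (metis of_nat_eq_0_iff less_numeral_extra(3))
      qed
      also have "\<dots> \<le> 2 * real x / G'"
      proof -
        \<comment> \<open>After multiplication by the modulus, at most R^2, the error terms of the
          count are still below x. This is the purpose of \<open>3 * R ^ 8 \<le> x\<close>.\<close>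
        have "real (\<Prod>F) * (1 + 2 * real R ^ 6) \<le> real (R\<^sup>2) * (real R ^ 6 + 2 * real R ^ 6)"
          using FR R by (intro mult_mono) (auto simp del: of_nat_prod)
        also have "\<dots> = real (3 * R ^ 8)" by (simp add: numeral_eq_Suc)
        also have "\<dots> \<le> real x" using R by (simp only: of_nat_le_iff)
        finally show ?thesis using G' by (intro divide_right_mono) auto
      qed
      also have "\<dots> \<le> 2 ^ card F * (2 * real x / G)"
      proof -
        have "1 / G' \<le> 2 ^ card F / G" using GG' G G' by (simp add: field_simps)
        hence "(2 * real x) * (1 / G') \<le> (2 * real x) * (2 ^ card F / G)"
          by (rule mult_left_mono) auto
        thus ?thesis by (simp add: mult_ac)
      qed
      also have "real (\<Prod>F) * real (card X) = (\<Sum>b\<in>A. if b \<in> X then real (\<Prod>F) else 0)"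
        using finA by (simp add: sum.If_cases X_def Int_def mult.commute)
      also have "\<dots> = (\<Sum>b\<in>A. \<Prod>p\<in>F. ?c p b)"
      proof (rule sum.cong[OF refl])
        fix b assume "b \<in> A"
        show "(if b \<in> X then real (\<Prod>F) else 0) = (\<Prod>p\<in>F. ?c p b)"
        proof (cases "b \<in> X")
          case False
          with \<open>b \<in> A\<close> obtain p where "p \<in> F" "\<not> int p dvd int a - int b" by (auto simp: X_def)
          hence "(\<Prod>p\<in>F. ?c p b) = 0" using finF by (intro prod_zero) auto
          thus ?thesis using False by simp
        qed (auto simp: X_def intro!: prod.cong)
      qed
      finally show "(\<Sum>b\<in>A. \<Prod>p\<in>F. ?c p b) \<le> 2 ^ card F * (2 * real x / G)" .
    qed
    also have "\<dots> = (\<Sum>F\<in>Pow D. 2 ^ card F) * (2 * real x / G)"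
      by (simp only: sum_distrib_right)
    also have "(\<Sum>F\<in>Pow D. 2 ^ card F) = (3::real) ^ card D"
      using prod_add[OF finD, of "\<lambda>_. 2::real" "\<lambda>_. 1"] by simp
    finally show ?thesis .
  qed
  hence "(\<Sum>a\<in>A. \<Sum>b\<in>A. \<bar>ramanujan_prod D (int a - int b)\<bar>) \<le> (\<Sum>a\<in>A. 3 ^ card D * (2 * real x / G))"
    by (intro sum_mono)
  thus ?thesis by (simp add: G_def)
qed

section \<open>Variance over the sums\<close>

lemma sum_inverse_squares_le:
  assumes "finite P" "\<And>p. p \<in> P \<Longrightarrow> z \<le> p" "z \<ge> (2::nat)"
  shows "(\<Sum>p\<in>P. 1 / (real p)\<^sup>2) \<le> 2 / real z"
proof -
  have tele: "(\<Sum>n\<in>{z..<z + k}. 1 / (real n)\<^sup>2) \<le> 1 / (real z - 1) - 1 / (real (z + k) - 1)" for k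
  proof (induction k)
    case (Suc k)
    let ?m = "real (z + k)"
    have m: "?m \<ge> 2" using assms(3) by simp
    have "1 / ?m\<^sup>2 \<le> 1 / (?m * (?m - 1))"
      unfolding power2_eq_square using m by (intro divide_left_mono mult_left_mono mult_pos_pos) auto
    also have "\<dots> = 1 / (?m - 1) - 1 / ?m"
      using m by (simp add: diff_frac_eq)
    finally have "1 / ?m\<^sup>2 \<le> 1 / (?m - 1) - 1 / ?m" .
    moreover have "(\<Sum>n\<in>{z..<z + Suc k}. 1 / (real n)\<^sup>2) = (\<Sum>n\<in>{z..<z + k}. 1 / (real n)\<^sup>2) + 1 / ?m\<^sup>2"
      by simp
    ultimately show ?case using Suc by simp
  qed simp
  obtain M where M: "\<forall>p\<in>P. p < M" using finite_nat_set_iff_bounded[of P] assms(1) by blast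
  have "(\<Sum>p\<in>P. 1 / (real p)\<^sup>2) \<le> (\<Sum>n\<in>{z..<z + M}. 1 / (real n)\<^sup>2)"
    using M assms(2) by (intro sum_mono2) fastforce+
  also have "\<dots> \<le> 1 / (real z - 1) - 1 / (real (z + M) - 1)" by (rule tele)
  also have "\<dots> \<le> 1 / (real z - 1)" using assms(3) by simp
  also have "\<dots> \<le> 2 / real z" using assms(3) by (simp add: field_simps)
  finally show ?thesis .
qed

text \<open>The sum over all subsets is an Euler product, bounded by an exponential. Omitting the
  empty set removes the term 1 and leaves the decisive gain 1/z. Here 48 = 4^2 * 3 combines the
  squared coefficient bound with the factor \<open>3 ^ card D\<close> for differences, and
  \<open>z \<ge> 96\<close> keeps the exponent at most 1, as \<open>exp_bound\<close>
  requires.\<close>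

lemma sum_levels_inverse_squares:
  assumes "finite P" "\<And>p. p \<in> P \<Longrightarrow> z \<le> p" "z \<ge> 96"
  shows "(\<Sum>D\<in>Pow P - {{}}. 48 ^ card D / (real (\<Prod>D))\<^sup>2) \<le> 192 / real z"
proof -
  let ?e = "96 / real z"
  have "(\<Sum>D\<in>Pow P. 48 ^ card D / (real (\<Prod>D))\<^sup>2) =
      (\<Sum>D\<in>Pow P. (\<Prod>p\<in>D. 48 / (real p)\<^sup>2) * (\<Prod>p\<in>P - D. 1))"
    by (intro sum.cong refl) (simp add: prod_dividef prod_power_distrib)
  also have "\<dots> = (\<Prod>p\<in>P. 48 / (real p)\<^sup>2 + 1)"
    by (rule prod_add[OF assms(1), symmetric])
  also have "\<dots> \<le> (\<Prod>p\<in>P. exp (48 / (real p)\<^sup>2))"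
    by (intro prod_mono) (auto simp: add.commute intro: exp_ge_add_one_self)
  also have "\<dots> = exp (48 * (\<Sum>p\<in>P. 1 / (real p)\<^sup>2))"
    using assms(1) by (simp add: exp_sum sum_distrib_left)
  also have "\<dots> \<le> exp ?e"
    using sum_inverse_squares_le[OF assms(1,2)] assms(3) by fastforce
  also have "\<dots> \<le> 1 + ?e + ?e\<^sup>2"
    using assms(3) by (intro exp_bound) auto
  also have "\<dots> \<le> 1 + ?e + ?e * 1"
    unfolding power2_eq_square using assms(3) by (intro add_left_mono mult_left_mono) auto
  finally have "(\<Sum>D\<in>Pow P. 48 ^ card D / (real (\<Prod>D))\<^sup>2) \<le> 1 + 192 / real z" by simp
  moreover have "(\<Sum>D\<in>Pow P. 48 ^ card D / (real (\<Prod>D))\<^sup>2) =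
      1 + (\<Sum>D\<in>Pow P - {{}}. 48 ^ card D / (real (\<Prod>D))\<^sup>2)"
    using assms(1) by (subst sum.remove[of _ "{}"]) auto
  ultimately show ?thesis by linarith
qed

text \<open>Subtracting the mean removes the empty set from the expansion. In the second moment,
  orthogonality leaves the diagonal \<open>D = E\<close>, which yields the term with 192 / z.
  Incomplete periods cost 2 R^8 for each pair from \<open>A\<close> and each of the at most R^4
  pairs \<open>D\<close>, \<open>E\<close>, hence the term with R^12.\<close>

lemma selberg_variance:
  assumes P: "finite P" "\<forall>p\<in>P. prime p" "\<forall>p\<in>P. z \<le> p" "z \<ge> 96" and R: "R > 0" "3 * R ^ 8 \<le> x"
    and A: "A \<subseteq> {..x}" "\<And>a p. a \<in> A \<Longrightarrow> p \<in> P \<Longrightarrow> \<not> p dvd a"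
  obtains \<delta> :: real where "\<delta> \<le> 1 / sieve_mass P R"
    "(\<Sum>n<N. ((\<Sum>a\<in>A. (selberg P R (int n - int a) / sieve_mass P R)\<^sup>2) - \<delta> * card A)\<^sup>2) \<le>
      (real N * (192 / real z) * (card A * (2 * real x / sieve_mass P R)) + 2 * real R ^ 12 * (real (card A))\<^sup>2) /
        (sieve_mass P R)\<^sup>2"
proof -
  define G where "G = sieve_mass P R"
  define L where "L = levels P (R\<^sup>2)"
  define L' where "L' = L - {{}}"
  have G: "G \<ge> 1" using P R sieve_mass_ge_1 by (simp add: G_def)
  obtain w where w: "\<And>n. (selberg P R n)\<^sup>2 = (\<Sum>D\<in>L. w D * ramanujan_prod D n)"
    "\<And>D. D \<in> L \<Longrightarrow> \<bar>w D\<bar> \<le> 4 ^ card D / real (\<Prod>D) * G"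
    using selberg_square_expansion[OF P(1,2), of R, folded L_def G_def] by blast
  define v where "v = (\<lambda>D. w D / G\<^sup>2)"
  have P4: "\<forall>p\<in>P. p \<ge> 4" using P by fastforce
  have finL: "finite L" "finite L'" using P by (auto simp: L_def L'_def)
  have finA: "finite A" using A finite_subset by blast
  have D: "finite D" "D \<subseteq> P" "\<Prod>D \<le> R\<^sup>2" "\<Prod>D > 0" if "D \<in> L" for D
  proof -
    show "finite D" "D \<subseteq> P" "\<Prod>D \<le> R\<^sup>2" 
      using that P finite_subset by (auto simp: L_def levels_def)
    thus "\<Prod>D > 0" using P by (intro prod_primes_pos) auto
  qed
  have vb: "\<bar>v D\<bar> \<le> 4 ^ card D / real (\<Prod>D) / G" if "D \<in> L" for D
  proof -
    have "\<bar>v D\<bar> = \<bar>w D\<bar> / G\<^sup>2" by (simp add: v_def)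
    also have "\<dots> \<le> (4 ^ card D / real (\<Prod>D) * G) / G\<^sup>2"
      using w(2)[OF that] by (intro divide_right_mono) auto
    finally show ?thesis using G by (simp add: power2_eq_square)
  qed
  have vb': "\<bar>v D\<bar> \<le> 1 / G" if "D \<in> L" for D
  proof -
    have "4 ^ card D / real (\<Prod>D) \<le> 1"
      using power4_card_le_prod[of D] D[OF that] P4
      by (subst divide_le_eq_1_pos) (auto simp del: of_nat_prod)
    hence "4 ^ card D / real (\<Prod>D) / G \<le> 1 / G" using G by (intro divide_right_mono) auto
    thus ?thesis using vb[OF that] by linarith
  qed
  have eL: "{} \<in> L" using R by (auto simp: L_def empty_in_levels)
  define C where "C = (\<lambda>D n. \<Sum>a\<in>A. ramanujan_prod D (int n - int a))"
  let ?f = "\<lambda>n. (\<Sum>a\<in>A. (selberg P R (int n - int a) / G)\<^sup>2) - v {} * card A"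
  have f: "?f n = (\<Sum>D\<in>L'. v D * C D n)" for n
  proof -
    have "(\<Sum>a\<in>A. (selberg P R (int n - int a) / G)\<^sup>2) = (\<Sum>a\<in>A. \<Sum>D\<in>L. v D * ramanujan_prod D (int n - int a))"
      by (simp add: power_divide w(1) v_def sum_divide_distrib)
    also have "\<dots> = (\<Sum>D\<in>L. v D * C D n)"
      by (subst sum.swap) (simp add: C_def sum_distrib_left)
    also have "\<dots> = v {} * C {} n + (\<Sum>D\<in>L'. v D * C D n)"
      unfolding L'_def using finL eL by (subst sum.remove[of _ "{}"]) auto
    finally show ?thesis by (simp add: C_def ramanujan_prod_def)
  qed
  have cc: "\<bar>\<Sum>n<N. C D n * C E n\<bar> \<le>
      (if D = E then real N * (card A * 3 ^ card D * (2 * real x / G)) else 0) + (real (card A))\<^sup>2 * (2 * real R ^ 8)"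
    if DE: "D \<in> L'" "E \<in> L'" for D E
  proof -
    have DL: "D \<in> L" "E \<in> L" using DE by (auto simp: L'_def)
    let ?c = "\<lambda>a b. \<bar>ramanujan_prod D (int a - int b)\<bar>"
    have *: "\<bar>\<Sum>n<N. ramanujan_prod D (int n - int a) * ramanujan_prod E (int n - int b)\<bar> \<le>
        (if D = E then real N * ?c a b else 0) + 2 * real R ^ 8" for a b
    proof -
      have "\<bar>(\<Sum>n<N. ramanujan_prod D (int n - int a) * ramanujan_prod E (int n - int b)) -
          real N * (if D = E then ramanujan_prod D (int a - int b) else 0)\<bar> \<le> 2 * (real (\<Prod>D) * real (\<Prod>E))\<^sup>2"
        using D[OF DL(1)] D[OF DL(2)] P by (intro ramanujan_prod_correlation) auto
      also have "\<dots> \<le> 2 * (real (R\<^sup>2) * real (R\<^sup>2))\<^sup>2"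
        using D(3)[OF DL(1)] D(3)[OF DL(2)]
        by (intro mult_left_mono power_mono mult_mono) (auto simp del: of_nat_prod)
      also have "\<dots> = 2 * real R ^ 8" by (simp add: power2_eq_square numeral_eq_Suc)
      finally have "\<bar>\<Sum>n<N. ramanujan_prod D (int n - int a) * ramanujan_prod E (int n - int b)\<bar> \<le>
          \<bar>real N * (if D = E then ramanujan_prod D (int a - int b) else 0)\<bar> + 2 * real R ^ 8"
        by linarith
      thus ?thesis by (auto simp: abs_mult split: if_splits)
    qed
    have "(\<Sum>n<N. C D n * C E n) =
        (\<Sum>n<N. \<Sum>a\<in>A. \<Sum>b\<in>A. ramanujan_prod D (int n - int a) * ramanujan_prod E (int n - int b))"
      unfolding C_def by (simp add: sum_product)
    also have "\<dots> = (\<Sum>a\<in>A. \<Sum>b\<in>A. \<Sum>n<N. ramanujan_prod D (int n - int a) * ramanujan_prod E (int n - int b))"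
      by (subst sum.swap, rule sum.cong[OF refl], rule sum.swap)
    also have "\<bar>\<dots>\<bar> \<le> (\<Sum>a\<in>A. \<Sum>b\<in>A. (if D = E then real N * ?c a b else 0) + 2 * real R ^ 8)"
      by (rule order.trans[OF sum_abs], rule sum_mono, rule order.trans[OF sum_abs], rule sum_mono, rule *)
    also have "\<dots> = (if D = E then real N * (\<Sum>a\<in>A. \<Sum>b\<in>A. ?c a b) else 0) + (real (card A))\<^sup>2 * (2 * real R ^ 8)"
      by (auto simp: sum.distrib sum_distrib_left power2_eq_square)
    also have "\<dots> \<le> (if D = E then real N * (card A * 3 ^ card D * (2 * real x / G)) else 0) +
        (real (card A))\<^sup>2 * (2 * real R ^ 8)"
      using mult_left_mono[OF sum_abs_ramanujan_prod_differences
        [OF P(1,2) P4 R A DL(1)[unfolded L_def], folded G_def], of "real N"] by auto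
    finally show ?thesis .
  qed
  show ?thesis
  \<comment> \<open>The mean is carried by the empty set, whose Ramanujan sum is identically
    1.\<close>
  proof (rule that[of "v {}"])
    show "v {} \<le> 1 / sieve_mass P R" using vb'[OF eL] by (simp add: G_def)
    let ?M = "real N * (card A * (2 * real x / G))" and ?E = "(real (card A))\<^sup>2 * (2 * real R ^ 8)"
    have "(\<Sum>n<N. (?f n)\<^sup>2) = (\<Sum>n<N. \<Sum>D\<in>L'. \<Sum>E\<in>L'. v D * v E * (C D n * C E n))"
      unfolding f unfolding power2_eq_square sum_product by (simp add: mult_ac)
    also have "\<dots> = (\<Sum>D\<in>L'. \<Sum>E\<in>L'. v D * v E * (\<Sum>n<N. C D n * C E n))"
      by (subst sum.swap, rule sum.cong[OF refl], subst sum.swap, simp add: sum_distrib_left)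
    also have "\<dots> \<le> (\<Sum>D\<in>L'. \<Sum>E\<in>L'. (if D = E then (v D)\<^sup>2 * 3 ^ card D * ?M else 0) + (1 / G)\<^sup>2 * ?E)"
    proof (intro sum_mono)
      fix D E assume DE: "D \<in> L'" "E \<in> L'"
      hence DL: "D \<in> L" "E \<in> L" by (auto simp: L'_def)
      let ?S = "\<Sum>n<N. C D n * C E n"
      have "v D * v E * ?S \<le> \<bar>v D\<bar> * \<bar>v E\<bar> * \<bar>?S\<bar>" by (metis abs_ge_self abs_mult)
      also have "\<dots> \<le> \<bar>v D\<bar> * \<bar>v E\<bar> * ((if D = E then real N * (card A * 3 ^ card D * (2 * real x / G)) else 0) + ?E)"
        by (intro mult_left_mono cc DE) auto
      also have "\<dots> = (if D = E then (v D)\<^sup>2 * 3 ^ card D * ?M else 0) + \<bar>v D\<bar> * \<bar>v E\<bar> * ?E"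
        by (auto simp: algebra_simps power2_eq_square)
      also have "\<bar>v D\<bar> * \<bar>v E\<bar> * ?E \<le> (1 / G)\<^sup>2 * ?E"
        unfolding power2_eq_square[of "1 / G"] using vb' DL G by (intro mult_right_mono mult_mono) auto
      finally show "v D * v E * ?S \<le> (if D = E then (v D)\<^sup>2 * 3 ^ card D * ?M else 0) + (1 / G)\<^sup>2 * ?E"
        by simp
    qed
    also have "\<dots> = (\<Sum>D\<in>L'. (v D)\<^sup>2 * 3 ^ card D) * ?M + (real (card L'))\<^sup>2 * ((1 / G)\<^sup>2 * ?E)"
    proof -
      have "(\<Sum>D\<in>L'. \<Sum>E\<in>L'. (if D = E then h D else 0) + q) = (\<Sum>D\<in>L'. h D) + (real (card L'))\<^sup>2 * q"
        for h :: "nat set \<Rightarrow> real" and q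
        using finL by (simp add: sum.distrib power2_eq_square)
      thus ?thesis by (simp only: sum_distrib_right)
    qed
    also have "\<dots> \<le> (1 / G\<^sup>2 * (192 / real z)) * ?M + (real (R\<^sup>2))\<^sup>2 * ((1 / G)\<^sup>2 * ?E)"
    proof (intro add_mono mult_right_mono power_mono)
      \<comment> \<open>The diagonal needs the sharp bound \<open>vb\<close>, whose factor 1 /
        \<open>\<Prod>D\<close> makes the series small; for the error terms the uniform
        \<open>vb'\<close> suffices.\<close>
      have "(\<Sum>D\<in>L'. (v D)\<^sup>2 * 3 ^ card D) \<le> (\<Sum>D\<in>L'. 1 / G\<^sup>2 * (48 ^ card D / (real (\<Prod>D))\<^sup>2))"
      proof (rule sum_mono)
        fix D assume "D \<in> L'"
        hence "\<bar>v D\<bar> \<le> 4 ^ card D / real (\<Prod>D) / G" using vb by (auto simp: L'_def)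
        hence "(v D)\<^sup>2 \<le> (4 ^ card D / real (\<Prod>D) / G)\<^sup>2"
          by (metis abs_ge_zero power2_abs power_mono)
        also have "\<dots> = 16 ^ card D / (real (\<Prod>D))\<^sup>2 / G\<^sup>2"
          by (simp add: power_divide power2_eq_square del: of_nat_prod flip: power_mult_distrib)
        finally have "(v D)\<^sup>2 * 3 ^ card D \<le> 16 ^ card D / (real (\<Prod>D))\<^sup>2 / G\<^sup>2 * 3 ^ card D"
          by (rule mult_right_mono) auto
        also have "\<dots> = 1 / G\<^sup>2 * ((16 ^ card D * 3 ^ card D) / (real (\<Prod>D))\<^sup>2)" by simp
        also have "(16 ^ card D * 3 ^ card D :: real) = 48 ^ card D" by (simp flip: power_mult_distrib)
        finally show "(v D)\<^sup>2 * 3 ^ card D \<le> 1 / G\<^sup>2 * (48 ^ card D / (real (\<Prod>D))\<^sup>2)" .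
      qed
      also have "\<dots> = 1 / G\<^sup>2 * (\<Sum>D\<in>L'. 48 ^ card D / (real (\<Prod>D))\<^sup>2)"
        by (simp only: sum_distrib_left)
      also have "\<dots> \<le> 1 / G\<^sup>2 * (\<Sum>D\<in>Pow P - {{}}. 48 ^ card D / (real (\<Prod>D))\<^sup>2)"
        using P by (intro mult_left_mono sum_mono2) (auto simp: L'_def L_def levels_def)
      also have "\<dots> \<le> 1 / G\<^sup>2 * (192 / real z)"
        using P by (intro mult_left_mono sum_levels_inverse_squares) auto
      finally show "(\<Sum>D\<in>L'. (v D)\<^sup>2 * 3 ^ card D) \<le> 1 / G\<^sup>2 * (192 / real z)" .
      have "card L' \<le> card L" using finL by (intro card_mono) (auto simp: L'_def)
      also have "\<dots> \<le> R\<^sup>2" using card_levels_le[OF P(1,2)] by (simp add: L_def)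
      finally show "real (card L') \<le> real (R\<^sup>2)" by (simp only: of_nat_le_iff)
    qed (use G in auto)
    also have "\<dots> = (real N * (192 / real z) * (card A * (2 * real x / G)) + 2 * real R ^ 12 * (real (card A))\<^sup>2) / G\<^sup>2"
    proof -
      have "(real (R\<^sup>2))\<^sup>2 * (2 * real R ^ 8) = 2 * real R ^ 12" by (simp add: numeral_eq_Suc)
      thus ?thesis by (simp add: add_divide_distrib power_divide mult_ac)
    qed
    finally show "(\<Sum>n<N. ((\<Sum>a\<in>A. (selberg P R (int n - int a) / sieve_mass P R)\<^sup>2) - v {} * card A)\<^sup>2) \<le>
      (real N * (192 / real z) * (card A * (2 * real x / sieve_mass P R)) + 2 * real R ^ 12 * (real (card A))\<^sup>2) /
        (sieve_mass P R)\<^sup>2"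
      unfolding G_def .
  qed
qed

text \<open>The first moment of the majorant on \<open>A + A\<close> is compared with its variance
  over all integers up to 2 x. The hypotheses \<open>main\<close> and
  \<open>4 * R ^ 12 \<le> card A\<close> each hold one of the two variance terms to a quarter of
  |A|^2, so half of the first moment must come from the mean.\<close>

lemma sumset_rough_lower_bound:
  assumes P: "finite P" "\<forall>p\<in>P. prime p" "\<forall>p\<in>P. z \<le> p" "z \<ge> 96" and R: "R > 0" "3 * R ^ 8 \<le> x"
    and A: "A \<subseteq> {..x}" "\<And>a p. a \<in> A \<Longrightarrow> p \<in> P \<Longrightarrow> \<not> p dvd a" "4 * R ^ 12 \<le> card A"
    and main: "2304 * (real x)\<^sup>2 \<le> real z * (sieve_mass P R * card A)\<^sup>2"
  shows "real (card (A + A)) \<ge> card A * sieve_mass P R / 3"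
proof -
  define G where "G = sieve_mass P R"
  define S where "S = A + A"
  define N where "N = 2 * x + 1"
  have G: "G \<ge> 1" using P R sieve_mass_ge_1 by (simp add: G_def)
  have finA: "finite A" using A finite_subset by blast
  have finS: "finite S" using finA by (simp add: S_def finite_set_plus)
  have x1: "x \<ge> 1" using R by (metis One_nat_def Suc_leI dual_order.trans mult_pos_pos zero_less_numeral zero_less_power)
  have A0: "card A > 0" using A(3) R by (metis mult_pos_pos order_less_le_trans zero_less_numeral zero_less_power)
  have SN: "S \<subseteq> {..<N}"
  proof
    fix s assume "s \<in> S"
    then obtain a b where "a \<in> A" "b \<in> A" "s = a + b" by (auto simp: S_def set_plus_def)
    moreover from this have "a \<le> x" "b \<le> x" using A(1) by auto
    ultimately show "s \<in> {..<N}" by (simp add: N_def)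
  qed
  obtain \<delta> :: real where \<delta>: "\<delta> \<le> 1 / G" and
    var: "(\<Sum>n<N. ((\<Sum>a\<in>A. (selberg P R (int n - int a) / G)\<^sup>2) - \<delta> * card A)\<^sup>2) \<le>
      (real N * (192 / real z) * (card A * (2 * real x / G)) + 2 * real R ^ 12 * (real (card A))\<^sup>2) / G\<^sup>2"
    using selberg_variance[OF P R A(1,2), of N, folded G_def] by metis
  define T where "T = (\<lambda>n::nat. \<Sum>a\<in>A. (selberg P R (int n - int a) / G)\<^sup>2)"
  define f where "f = (\<lambda>n. T n - \<delta> * card A)"
  \<comment> \<open>An upper bound for the mean \<open>\<delta> * card A\<close> of
    \<open>T\<close>, and the scale against which deviations are measured.\<close>
  define t where "t = card A / G"
  have t: "t > 0" using A0 G by (simp add: t_def)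
  \<comment> \<open>For each a, the card A sums a + b are distinct points of \<open>S\<close>, and
    the term of a has value 1 there because b is unsieved.\<close>
  have "(real (card A))\<^sup>2 = (\<Sum>a\<in>A. \<Sum>s\<in>(\<lambda>b. a + b) ` A. 1)"
    by (simp add: card_image power2_eq_square)
  also have "\<dots> \<le> (\<Sum>a\<in>A. \<Sum>s\<in>S. (selberg P R (int s - int a) / G)\<^sup>2)"
  proof (rule sum_mono)
    fix a assume a: "a \<in> A"
    have "(\<Sum>s\<in>(\<lambda>b. a + b) ` A. 1) = (\<Sum>s\<in>(\<lambda>b. a + b) ` A. (selberg P R (int s - int a) / G)\<^sup>2)"
    proof (rule sum.cong[OF refl])
      fix s assume "s \<in> (\<lambda>b. a + b) ` A"
      then obtain b where b: "b \<in> A" "int s - int a = int b" by auto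
      thus "1 = (selberg P R (int s - int a) / G)\<^sup>2"
        using selberg_rough[of P "int b" R] A(2)[OF b(1)] G by (simp add: G_def)
    qed
    also have "\<dots> \<le> (\<Sum>s\<in>S. (selberg P R (int s - int a) / G)\<^sup>2)"
      using a finS by (intro sum_mono2) (auto simp: S_def set_plus_def)
    finally show "(\<Sum>s\<in>(\<lambda>b. a + b) ` A. 1) \<le> (\<Sum>s\<in>S. (selberg P R (int s - int a) / G)\<^sup>2)" .
  qed
  also have "\<dots> = (\<Sum>s\<in>S. T s)" unfolding T_def by (rule sum.swap)
  \<comment> \<open>The inequality f \<le> t/2 + f^2/(2t) makes the deviation quadratic, so that its
    sum over \<open>S\<close> can be extended to all n below \<open>N\<close>.\<close>
  also have "\<dots> \<le> (\<Sum>s\<in>S. 3 / 2 * t + (f s)\<^sup>2 / (2 * t))"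
  proof (rule sum_mono)
    fix s
    have "0 \<le> (f s - t)\<^sup>2 / (2 * t)" using t by simp
    also have "\<dots> = t / 2 + (f s)\<^sup>2 / (2 * t) - f s"
      using t by (simp add: power2_eq_square field_simps)
    finally have "f s \<le> t / 2 + (f s)\<^sup>2 / (2 * t)" by simp
    moreover have "\<delta> * card A \<le> 1 / G * card A" using \<delta> by (intro mult_right_mono) auto
    hence "\<delta> * card A \<le> t" by (simp add: t_def)
    ultimately show "T s \<le> 3 / 2 * t + (f s)\<^sup>2 / (2 * t)" by (simp add: f_def)
  qed
  also have "\<dots> = 3 / 2 * t * card S + (\<Sum>s\<in>S. (f s)\<^sup>2) / (2 * t)"
    by (simp add: sum.distrib sum_divide_distrib)
  also have "(\<Sum>s\<in>S. (f s)\<^sup>2) / (2 * t) \<le> (real (card A))\<^sup>2 / 2"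
  proof -
    have "(\<Sum>s\<in>S. (f s)\<^sup>2) \<le> (\<Sum>n<N. (f n)\<^sup>2)" using SN by (intro sum_mono2) auto
    also have "\<dots> \<le> (real N * (192 / real z) * (card A * (2 * real x / G)) + 2 * real R ^ 12 * (real (card A))\<^sup>2) / G\<^sup>2"
      using var by (simp add: f_def T_def)
    finally have "(\<Sum>s\<in>S. (f s)\<^sup>2) / (2 * t) \<le>
      (real N * (192 / real z) * (card A * (2 * real x / G)) + 2 * real R ^ 12 * (real (card A))\<^sup>2) / G\<^sup>2 / (2 * t)"
      using t by (intro divide_right_mono) auto
    also have "\<dots> = real N * 192 * real x / (real z * G\<^sup>2) + real R ^ 12 * card A / G"
      using G A0 P(4) by (simp add: t_def field_simps power2_eq_square)
    also have "\<dots> \<le> (real (card A))\<^sup>2 / 4 + (real (card A))\<^sup>2 / 4"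
    proof (rule add_mono)
      \<comment> \<open>Since N = 2 x + 1 \<le> 3 x, the constant needed in \<open>main\<close> is 4
        * 3 * 192 = 2304.\<close>
      have "real N * 192 * real x \<le> (3 * real x) * 192 * real x"
        using x1 by (intro mult_right_mono) (auto simp: N_def)
      also have "\<dots> \<le> (real (card A))\<^sup>2 / 4 * (real z * G\<^sup>2)"
        using main by (simp add: G_def power2_eq_square algebra_simps)
      finally show "real N * 192 * real x / (real z * G\<^sup>2) \<le> (real (card A))\<^sup>2 / 4"
        using G P(4) by (subst pos_divide_le_eq) auto
      have "real R ^ 12 \<le> real (card A) / 4"
      proof -
        have "real (4 * R ^ 12) \<le> real (card A)" using A(3) by (simp only: of_nat_le_iff)
        thus ?thesis by simp
      qed
      hence "real R ^ 12 * card A \<le> real (card A) / 4 * card A" by (intro mult_right_mono) auto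
      hence *: "real R ^ 12 * card A \<le> (real (card A))\<^sup>2 / 4" by (simp add: power2_eq_square)
      have "real R ^ 12 * card A / G \<le> real R ^ 12 * card A / 1"
        using G by (intro divide_left_mono) auto
      thus "real R ^ 12 * card A / G \<le> (real (card A))\<^sup>2 / 4" using * by linarith
    qed
    finally show ?thesis by simp
  qed
  finally have "(real (card A))\<^sup>2 \<le> 3 / 2 * t * card S + (real (card A))\<^sup>2 / 2" by simp
  hence "real (card A) * (card A * G) \<le> real (card A) * (3 * card S)"
    using G by (simp add: t_def power2_eq_square field_simps)
  hence "card A * G \<le> 3 * card S" using A0 by (simp only: mult_le_cancel_left_pos of_nat_0_less_iff)
  thus ?thesis by (simp add: G_def S_def)
qed

section \<open>Estimates for primes\<close>

definition primes_upto :: "nat \<Rightarrow> nat set" where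
  "primes_upto n = {p. prime p \<and> p \<le> n}"

lemma finite_primes_upto [simp]: "finite (primes_upto n)"
  by (rule finite_subset[of _ "{..n}"]) (auto simp: primes_upto_def)

lemma primes_upto_Suc:
  "primes_upto (Suc n) = (if prime (Suc n) then insert (Suc n) (primes_upto n) else primes_upto n)"
  by (auto simp: primes_upto_def le_Suc_eq)

lemma prod_primes_dvd:
  assumes "finite F" "\<And>p. p \<in> F \<Longrightarrow> prime (p::nat)" "\<And>p. p \<in> F \<Longrightarrow> p ^ e p dvd n"
  shows "(\<Prod>p\<in>F. p ^ e p) dvd (n::nat)"
  using assms
proof (induction F rule: finite_induct)
  case (insert q F)
  have "coprime (q ^ e q) (\<Prod>p\<in>F. p ^ e p)"
    by (rule prod_coprime_right) (use insert in \<open>auto intro!: primes_coprime\<close>)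
  thus ?case using insert by (auto intro: divides_mult)
qed simp

text \<open>Erdos's argument. For n = 2 m + 1, the primes in (m + 1, n] all divide the binomial
  coefficient of n over m, which is at most 4^m because it occurs twice in its row; the primes up to
  m + 1 are covered by induction. An even n > 2 adds no prime.\<close>

lemma primorial_le: "\<Prod>(primes_upto n) \<le> 4 ^ n"
proof (induction n rule: less_induct)
  case (less n)
  consider "n \<le> 2" | "n > 2" "even n" | "n > 2" "odd n" by linarith
  thus ?case
  proof cases
    case 1
    hence "n = 0 \<or> n = 1 \<or> n = 2" by auto
    moreover have "primes_upto 0 = {}" "primes_upto 1 = {}" "primes_upto 2 = {2}"
      using two_is_prime_nat by (auto simp: primes_upto_def dest: prime_ge_2_nat)
    ultimately show ?thesis by auto
  next
    case 2
    then obtain m where m: "n = Suc m" using not0_implies_Suc[of n] by auto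
    have "\<not> prime n" using 2 primes_dvd_imp_eq[of 2 n] two_is_prime_nat by auto
    hence "\<Prod>(primes_upto n) = \<Prod>(primes_upto m)" by (simp add: m primes_upto_Suc)
    also have "\<dots> \<le> 4 ^ m" using less m by simp
    also have "\<dots> \<le> 4 ^ n" by (simp add: m)
    finally show ?thesis .
  next
    case 3
    then obtain m where m: "n = 2 * m + 1" by (auto elim: oddE)
    hence m1: "m \<ge> 1" using 3 by simp
    define B where "B = {p. prime p \<and> m + 1 < p \<and> p \<le> n}"
    have B: "finite B" by (rule finite_subset[of _ "{..n}"]) (auto simp: B_def)
    have "\<Prod>B dvd n choose m"
    proof -
      have "p ^ 1 dvd n choose m" if "p \<in> B" for p
      proof -
        have p: "prime p" "m + 1 < p" "p \<le> n" using that by (auto simp: B_def)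
        have "fact m * fact (n - m) * (n choose m) = (fact n :: nat)"
          using m by (intro binomial_fact_lemma) auto
        moreover have "p dvd fact n" using p by (simp add: prime_dvd_fact_iff)
        moreover have "\<not> p dvd fact m" "\<not> p dvd fact (n - m)"
          using p m prime_dvd_fact_iff[OF p(1)] by (simp_all del: fact_Suc)
        ultimately show ?thesis using p by (metis power_one_right prime_dvd_mult_iff)
      qed
      hence "(\<Prod>p\<in>B. p ^ 1) dvd n choose m"
        using B by (intro prod_primes_dvd) (auto simp: B_def)
      thus ?thesis by simp
    qed
    moreover have "n choose m > 0" using m by simp
    ultimately have "\<Prod>B \<le> n choose m" by (intro dvd_imp_le)
    also have "n choose m \<le> 4 ^ m"
    proof -
      have "n choose (Suc m) = n choose m" using central_binomial_odd[of n] m by simp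
      moreover have "(\<Sum>k\<in>{m, Suc m}. n choose k) \<le> (\<Sum>k\<le>n. n choose k)"
        using m by (intro sum_mono2) auto
      ultimately have "2 * (n choose m) \<le> 2 ^ n" by (simp add: choose_row_sum)
      thus ?thesis by (simp add: m power_mult)
    qed
    finally have "\<Prod>B \<le> 4 ^ m" .
    moreover have "\<Prod>(primes_upto (m + 1)) \<le> 4 ^ (m + 1)" using m m1 by (intro less.IH) simp
    moreover have "primes_upto n = primes_upto (m + 1) \<union> B" "primes_upto (m + 1) \<inter> B = {}"
      using m by (auto simp: primes_upto_def B_def)
    hence "\<Prod>(primes_upto n) = \<Prod>(primes_upto (m + 1)) * \<Prod>B"
      using B by (simp add: prod.union_disjoint)
    ultimately have "\<Prod>(primes_upto n) \<le> 4 ^ (m + 1) * 4 ^ m" by (simp add: mult_le_mono)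
    also have "\<dots> = 4 ^ n" by (simp add: m power_add[symmetric] mult_2)
    finally show ?thesis .
  qed
qed

lemma sum_ln_primes_le: "(\<Sum>p\<in>primes_upto n. ln (real p)) \<le> real n * ln 4"
proof -
  have pos: "\<forall>p\<in>primes_upto n. p > 0" by (auto simp: primes_upto_def prime_gt_0_nat)
  have "(\<Sum>p\<in>primes_upto n. ln (real p)) = ln (\<Prod>p\<in>primes_upto n. real p)"
    using pos by (subst ln_prod) auto
  also have "\<dots> \<le> ln (4 ^ n)"
  proof (rule ln_mono)
    show "(\<Prod>p\<in>primes_upto n. real p) > 0" using pos by (intro prod_pos) auto
    have "real (\<Prod>(primes_upto n)) \<le> real (4 ^ n)" using primorial_le by (simp only: of_nat_le_iff)
    thus "(\<Prod>p\<in>primes_upto n. real p) \<le> 4 ^ n" by simp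
  qed
  finally show ?thesis by (simp add: ln_realpow)
qed

text \<open>The multiples of \<open>p\<close> up to \<open>n\<close> are \<open>n div p\<close>
  distinct factors of the factorial. Higher powers of \<open>p\<close> are ignored, since only a
  lower bound for the exponent is needed.\<close>

lemma prime_power_dvd_fact: "(p::nat) > 0 \<Longrightarrow> p ^ (n div p) dvd fact n"
proof -
  assume p: "p > 0"
  let ?k = "n div p"
  have "p ^ ?k dvd p ^ ?k * (\<Prod>i\<in>{1..?k}. i)" by simp
  also have "p ^ ?k * (\<Prod>i\<in>{1..?k}. i) = (\<Prod>i\<in>{1..?k}. p * i)"
    by (simp only: prod.distrib prod_constant card_atLeastAtMost diff_Suc_1)
  also have "\<dots> = \<Prod>((\<lambda>i. p * i) ` {1..?k})"
    using p by (subst prod.reindex) (auto intro!: inj_onI)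
  also have "\<dots> dvd \<Prod>{1..n}"
  proof (rule prod_dvd_prod_subset)
    have "p * i \<le> n" if "i \<le> n div p" for i
      using that p by (metis div_times_less_eq_dividend dual_order.trans mult.commute mult_le_mono2)
    thus "(\<lambda>i. p * i) ` {1..n div p} \<subseteq> {1..n}" using p by (auto simp: Suc_le_eq)
  qed simp
  finally show ?thesis by (simp add: fact_prod)
qed

text \<open>The upper half of Mertens's first theorem: the prime powers found in n! are compared
  with n^n. Replacing \<open>n div p\<close> by n / p costs at most ln p per prime, in total
  \<open>n * ln 4\<close> by Chebyshev's bound.\<close>

lemma sum_ln_over_primes_le:
  assumes "n > 0"
  shows "(\<Sum>p\<in>primes_upto n. ln (real p) / real p) \<le> ln (real n) + ln 4"
proof -
  have pos: "p > 0" "prime p" if "p \<in> primes_upto n" for p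
    using that by (auto simp: primes_upto_def prime_gt_0_nat)
  have "(\<Prod>p\<in>primes_upto n. p ^ (n div p)) \<le> fact n"
    using pos by (intro dvd_imp_le prod_primes_dvd prime_power_dvd_fact) auto
  also have "\<dots> \<le> n ^ n" using fact_le_power[of n, where ?'a = nat] by simp
  finally have "real (\<Prod>p\<in>primes_upto n. p ^ (n div p)) \<le> real (n ^ n)" by (simp only: of_nat_le_iff)
  hence "ln (\<Prod>p\<in>primes_upto n. real p ^ (n div p)) \<le> ln (real n ^ n)"
    using pos assms by (intro ln_mono) (auto intro!: prod_pos)
  also have "\<dots> = n * ln (real n)" using assms by (simp add: ln_realpow)
  also have "ln (\<Prod>p\<in>primes_upto n. real p ^ (n div p)) = (\<Sum>p\<in>primes_upto n. (n div p) * ln (real p))"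
    using pos by (subst ln_prod) (auto simp: ln_realpow intro!: sum.cong)
  finally have *: "(\<Sum>p\<in>primes_upto n. (n div p) * ln (real p)) \<le> n * ln (real n)" .
  have "n * (\<Sum>p\<in>primes_upto n. ln (real p) / real p) \<le>
      (\<Sum>p\<in>primes_upto n. (n div p) * ln (real p) + ln (real p))"
    unfolding sum_distrib_left
  proof (rule sum_mono)
    fix p assume p: "p \<in> primes_upto n"
    have "n = n div p * p + n mod p" by simp
    also have "\<dots> \<le> n div p * p + p"
      using mod_less_divisor[OF pos(1)[OF p], of n] by linarith
    finally have "real n \<le> real (n div p * p + p)" by (simp only: of_nat_le_iff)
    hence "real n / real p \<le> real (n div p) + 1" using pos(1)[OF p] by (simp add: field_simps)
    moreover have "ln (real p) \<ge> 0" using pos(1)[OF p] by simp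
    ultimately have "real n / real p * ln (real p) \<le> (real (n div p) + 1) * ln (real p)"
      by (rule mult_right_mono)
    thus "real n * (ln (real p) / real p) \<le> (n div p) * ln (real p) + ln (real p)"
      by (simp add: algebra_simps)
  qed
  also have "\<dots> \<le> n * ln (real n) + n * ln 4"
    using * sum_ln_primes_le[of n] by (simp add: sum.distrib)
  also have "\<dots> = n * (ln (real n) + ln 4)" by (simp add: algebra_simps)
  finally show ?thesis using assms by (simp only: mult_le_cancel_left_pos of_nat_0_less_iff)
qed

text \<open>Partial summation from \<open>ln p / p\<close> to \<open>1 / p\<close>, carried out as an induction on the upper limit;
  it rests on \<open>1 - v / u \<le> ln (u / v)\<close> for \<open>v = ln n\<close> and \<open>u = ln (n + 1)\<close>.\<close>

lemma sum_inverse_primes_le: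
  assumes "n \<ge> 2"
  shows "(\<Sum>p\<in>primes_upto n. 1 / real p) \<le> ln (ln (real n)) + (3 - ln (ln 2))"
proof -
  define B where "B = (\<lambda>n. \<Sum>p\<in>primes_upto n. 1 / real p)"
  define A where "A = (\<lambda>n. \<Sum>p\<in>primes_upto n. ln (real p) / real p)"
  have "B n - A n / ln (real n) \<le> ln (ln (real n)) - ln (ln 2) + ln 4 * (1 / ln 2 - 1 / ln (real n))"
    using assms
  proof (induction n rule: dec_induct)
    case base
    have "primes_upto 2 = {2}"
      by (auto simp: primes_upto_def dest: prime_ge_2_nat)
    thus ?case by (simp add: A_def B_def)
  next
    case (step n)
    define v where "v = ln (real n)"
    define u where "u = ln (real (Suc n))"
    have v: "v > 0" and u: "u \<ge> v" using step by (auto simp: u_def v_def)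
    \<comment> \<open>A new prime n + 1 adds 1/(n + 1) to \<open>B\<close> and, after division by
      \<open>u\<close>, the same amount to \<open>A\<close>; the two cancel.\<close>
    have "B (Suc n) - A (Suc n) / u = B n - A n / u"
    proof (cases "prime (Suc n)")
      case True
      have "Suc n \<notin> primes_upto n" by (auto simp: primes_upto_def)
      moreover have "u > 0" using u v by simp
      ultimately show ?thesis using True
        by (simp add: A_def B_def primes_upto_Suc u_def add_divide_distrib del: of_nat_Suc)
    qed (simp add: A_def B_def primes_upto_Suc)
    also have "\<dots> = (B n - A n / v) + A n * (1 / v - 1 / u)" by (simp add: algebra_simps)
    also have "A n * (1 / v - 1 / u) \<le> (v + ln 4) * (1 / v - 1 / u)"
      using sum_ln_over_primes_le[of n] step u v
      by (intro mult_right_mono) (auto simp: A_def v_def[symmetric] intro!: divide_left_mono)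
    also have "\<dots> = (1 - v / u) + ln 4 * (1 / v - 1 / u)"
      using v u by (simp add: algebra_simps)
    also have "1 - v / u \<le> ln u - ln v"
      using ln_le_minus_one[of "v / u"] v u by (simp add: ln_div)
    finally show ?case using step.IH by (simp add: u_def[symmetric] v_def[symmetric] algebra_simps del: of_nat_Suc)
  qed
  \<comment> \<open>The 1 here and \<open>ln 4 / ln 2 = 2\<close> form the constant 3; the two terms
    \<open>ln 4 / ln (real n)\<close> cancel.\<close>
  moreover have "A n / ln (real n) \<le> 1 + ln 4 / ln (real n)"
    using sum_ln_over_primes_le[of n] assms by (simp add: A_def field_simps)
  moreover have "ln 4 / ln 2 = (2::real)" using ln_realpow[of 2 2] by simp
  ultimately show ?thesis by (simp add: B_def algebra_simps)
qed

lemma prod_primes_one_plus_inverse_le: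
  assumes "n \<ge> 2"
  shows "(\<Prod>p\<in>primes_upto n. 1 + 1 / real p) \<le> exp 3 / ln 2 * ln (real n)"
proof -
  have "(\<Prod>p\<in>primes_upto n. 1 + 1 / real p) \<le> (\<Prod>p\<in>primes_upto n. exp (1 / real p))"
    by (intro prod_mono) auto
  also have "\<dots> = exp (\<Sum>p\<in>primes_upto n. 1 / real p)" by (simp add: exp_sum)
  also have "\<dots> \<le> exp (ln (ln (real n)) + (3 - ln (ln 2)))"
    using sum_inverse_primes_le[OF assms] by simp
  also have "\<dots> = exp 3 / ln 2 * ln (real n)"
    using assms by (simp add: exp_add exp_diff)
  finally show ?thesis .
qed

section \<open>Lower bound for the sieve mass\<close>

lemma prod_prime_factors_squarefree:
  assumes "squarefree (q::nat)" "q > 0"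
  shows "\<Prod>(prime_factors q) = q"
proof -
  have "(\<Prod>p\<in>prime_factors q. p ^ multiplicity p q) = (\<Prod>p\<in>prime_factors q. p)"
  proof (rule prod.cong[OF refl])
    fix p assume p: "p \<in> prime_factors q"
    hence "multiplicity p q > 0" by (simp add: prime_factors_multiplicity)
    moreover have "multiplicity p q \<le> 1"
      using assms p squarefree_factorial_semiring''[of q] by (auto simp: in_prime_factors_iff)
    ultimately have "multiplicity p q = 1" by linarith
    thus "p ^ multiplicity p q = p" by simp
  qed
  thus ?thesis using prod_prime_factors[of q] assms by simp
qed

text \<open>Each n up to \<open>R\<close> is a squarefree number times a square, so the harmonic sum
  is at most the mass times the sum of 1/m^2, which is below 2.\<close>

lemma ln_le_sieve_mass:
  assumes "R > 0"
  shows "ln (real R) \<le> 2 * sieve_mass (primes_upto R) R"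
proof -
  let ?P = "primes_upto R"
  define \<phi> where "\<phi> = (\<lambda>n. (prime_factors (squarefree_part n :: nat), square_part n))"
  define g where "g = (\<lambda>(D::nat set, m::nat). 1 / real (\<Prod>D) * (1 / (real m)\<^sup>2))"
  have q: "\<Prod>(prime_factors (squarefree_part n)) = squarefree_part n" if "n > 0" for n :: nat
    using that by (intro prod_prime_factors_squarefree) (auto intro!: Nat.gr0I)
  have dec: "n = squarefree_part n * square_part n ^ 2" for n :: nat by (rule squarefree_decompose)
  have "ln (real R) \<le> ln (real R + 1)" using assms by simp
  also have "\<dots> \<le> harm R" by (rule harm_ge_ln)
  also have "\<dots> = (\<Sum>n\<in>{1..R}. g (\<phi> n))"
    unfolding harm_def
  proof (rule sum.cong[OF refl])
    fix n assume "n \<in> {1..R}"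
    hence n: "n > 0" by simp
    have "real n = real (squarefree_part n * (square_part n)\<^sup>2)"
      using dec[of n] by simp
    hence "real n = real (squarefree_part n) * (real (square_part n))\<^sup>2" by simp
    thus "inverse (real n) = g (\<phi> n)"
      unfolding g_def \<phi>_def case_prod_conv q[OF n] by (simp add: field_simps)
  qed
  also have "\<dots> = sum g (\<phi> ` {1..R})"
  proof (subst sum.reindex)
    show "inj_on \<phi> {1..R}"
    proof (rule inj_onI)
      fix a b assume *: "a \<in> {1..R}" "b \<in> {1..R}" "\<phi> a = \<phi> b"
      have "prime_factors (squarefree_part a) = prime_factors (squarefree_part b)"
        and sq: "square_part a = square_part b" using *(3) by (simp_all only: \<phi>_def prod.inject)
      moreover have "a > 0" "b > 0" using * by auto
      ultimately have "squarefree_part a = squarefree_part b" using q by metis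
      thus "a = b" using sq dec[of a] dec[of b] by metis
    qed
  qed simp
  also have "\<dots> \<le> sum g (levels ?P R \<times> {1..R})"
  proof (rule sum_mono2)
    show "\<phi> ` {1..R} \<subseteq> levels ?P R \<times> {1..R}"
    proof (rule image_subsetI)
      fix n assume n: "n \<in> {1..R}"
      have pos: "squarefree_part n > 0" "square_part n > 0"
        using n by (auto intro!: Nat.gr0I)
      have "squarefree_part n dvd n" "square_part n dvd n"
        by (metis dec dvd_triv_left, metis dec dvd_mult dvd_power zero_less_numeral)
      hence le: "squarefree_part n \<le> R" "square_part n \<le> R"
        using n by (auto dest!: dvd_imp_le)
      have "prime_factors (squarefree_part n) \<subseteq> ?P"
      proof
        fix p assume "p \<in> prime_factors (squarefree_part n)"
        hence "prime p" "p dvd squarefree_part n" by auto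
        thus "p \<in> ?P" using le pos by (auto simp: primes_upto_def dest!: dvd_imp_le)
      qed
      thus "\<phi> n \<in> levels ?P R \<times> {1..R}"
        using le pos q[of n] n by (auto simp: \<phi>_def levels_def)
    qed
  qed (auto simp: g_def prod_nonneg)
  also have "\<dots> = sieve_mass ?P R * (\<Sum>m\<in>{1..R}. 1 / (real m)\<^sup>2)"
    unfolding sieve_mass_def g_def sum_product sum.cartesian_product by simp
  also have "(\<Sum>m\<in>{1..R}. 1 / (real m)\<^sup>2) \<le> 2"
  proof -
    have "(\<Sum>m\<in>{1..R}. 1 / (real m)\<^sup>2) = 1 + (\<Sum>m\<in>{2..R}. 1 / (real m)\<^sup>2)"
      using assms by (subst sum.atLeast_Suc_atMost) (auto simp: numeral_2_eq_2)
    also have "(\<Sum>m\<in>{2..R}. 1 / (real m)\<^sup>2) \<le> 2 / real 2"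
      by (rule sum_inverse_squares_le) auto
    finally show ?thesis by simp
  qed
  finally show ?thesis
    using sieve_mass_ge_1[of ?P R] assms by (simp add: mult.commute mult_left_mono)
qed

text \<open>Sieving by all primes up to \<open>R\<close> gives mass of order ln R; removing those
  below \<open>z\<close> costs the Mertens product, of order ln z.\<close>

lemma sieve_mass_lower_bound:
  assumes "R > 0" "z \<ge> 2"
  shows "ln 2 / (2 * exp 3) * (ln (real R) / ln (real z)) \<le> sieve_mass {p\<in>primes_upto R. z \<le> p} R"
proof -
  let ?P = "{p\<in>primes_upto R. z \<le> p}" and ?F = "{p. prime p \<and> p < z}"
  have F: "?F \<subseteq> primes_upto z" by (auto simp: primes_upto_def)
  have G: "sieve_mass ?P R \<ge> 1" using assms by (intro sieve_mass_ge_1) auto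
  have lnz: "ln (real z) > 0" using assms by simp
  have "ln (real R) \<le> 2 * sieve_mass (primes_upto R) R" using assms by (intro ln_le_sieve_mass)
  also have "\<dots> \<le> 2 * ((\<Prod>p\<in>?F. 1 + 1 / real p) * sieve_mass (primes_upto R - ?F) R)"
    using F finite_subset by (intro mult_left_mono sieve_mass_le_prod_Diff) (auto simp: primes_upto_def)
  also have "primes_upto R - ?F = ?P" by (auto simp: primes_upto_def)
  also have "(\<Prod>p\<in>?F. 1 + 1 / real p) \<le> (\<Prod>p\<in>primes_upto z. 1 + 1 / real p)"
    using F by (intro prod_mono2) auto
  also have "\<dots> \<le> exp 3 / ln 2 * ln (real z)" by (rule prod_primes_one_plus_inverse_le[OF assms(2)])
  finally have "ln (real R) \<le> 2 * (exp 3 / ln 2 * ln (real z) * sieve_mass ?P R)"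
    using G by (simp add: mult_right_mono)
  thus ?thesis using lnz by (simp add: field_simps)
qed

text \<open>Primes up to \<open>y\<close> are counted trivially; each larger one contributes at
  least ln y to Chebyshev's sum.\<close>

lemma card_primes_le:
  assumes "A \<subseteq> primes_upto n" "y > 1"
  shows "real (card A) \<le> y + real n * ln 4 / ln y"
proof -
  let ?B = "{p\<in>A. real p \<le> y}" and ?C = "{p\<in>A. real p > y}"
  have finA: "finite A" using assms(1) finite_primes_upto by (rule finite_subset)
  have "card ?B \<le> card {1..nat \<lfloor>y\<rfloor>}"
  proof (rule card_mono)
    show "?B \<subseteq> {1..nat \<lfloor>y\<rfloor>}"
      using assms by (auto simp: primes_upto_def le_nat_floor Suc_le_eq prime_gt_0_nat)
  qed simp
  hence "real (card ?B) \<le> real (nat \<lfloor>y\<rfloor>)" by simp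
  also have "\<dots> \<le> y" using assms(2) by (intro of_nat_floor) simp
  finally have B: "real (card ?B) \<le> y" .
  have "real (card ?C) * ln y = (\<Sum>p\<in>?C. ln y)" by simp
  also have "\<dots> \<le> (\<Sum>p\<in>?C. ln (real p))" using assms(2) by (intro sum_mono) auto
  also have "\<dots> \<le> (\<Sum>p\<in>primes_upto n. ln (real p))"
    using assms by (intro sum_mono2) (auto simp: primes_upto_def Suc_le_eq prime_gt_0_nat)
  also have "\<dots> \<le> n * ln 4" by (rule sum_ln_primes_le)
  finally have "real (card ?C) \<le> n * ln 4 / ln y"
    using assms(2) by (simp add: pos_le_divide_eq)
  moreover have "card A = card ?B + card ?C"
    using finA by (subst card_Un_disjoint[symmetric]) (auto intro!: arg_cong[of _ _ card])
  ultimately show ?thesis using B by simp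
qed

section \<open>Choice of parameters\<close>

text \<open>The inequality with 8/5 is for \<open>card_primes_le\<close> at y = x^(9/10), with 25/18
  an upper bound for ln 4; it works because 25/18 * 10/9 < 8/5. The conditions with x^(1/26) concern
  the sieve level R: its logarithm, its 8th power against x, and its 12th power against x^(3/4) / ln
  x, a lower bound for |A| when \<alpha> \<ge> x^(-1/4).\<close>

lemma eventually_numeric_conditions:
  "\<forall>\<^sub>F x :: real in at_top. x \<ge> 3 \<and> x powr (9/10) + x * (25/18) / (9/10 * ln x) \<le> 8/5 * (x / ln x) \<and>
     x powr (1/26) \<ge> 2 \<and> ln (x powr (1/26) - 1) \<ge> ln x / 30 \<and> 3 * x powr (8/26) \<le> x - 1 \<and>
     8 * x powr (12/26) \<le> x powr (3/4) / ln x"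
  by (intro eventually_conj; real_asymp)

text \<open>The first conclusion keeps ln (2 / \<alpha>) away from 0, so that additive constants can
  be absorbed into it. In the second, 180 = 30 * 3 * 2 collects the losses from ln R \<ge> ln x /
  30, from \<open>sumset_rough_lower_bound\<close>, and from discarding up to half of
  \<open>A\<close>.\<close>

lemma sumset_primes_lower_bound:
  fixes x \<alpha> c\<^sub>1 M :: real and A :: "nat set"
  defines "c\<^sub>1 \<equiv> ln 2 / (2 * exp 3)" and "M \<equiv> 5 + 138240 / c\<^sub>1"
  assumes x: "x \<ge> 3" "x powr (9/10) + x * (25/18) / (9/10 * ln x) \<le> 8/5 * (x / ln x)"
    "x powr (1/26) \<ge> 2" "ln (x powr (1/26) - 1) \<ge> ln x / 30" "3 * x powr (8/26) \<le> x - 1"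
    "8 * x powr (12/26) \<le> x powr (3/4) / ln x"
  and A: "\<And>p. p \<in> A \<Longrightarrow> prime p \<and> real p \<le> x" "A \<noteq> {}"
  and \<alpha>: "real (card A) = \<alpha> * x * inverse (ln x)"
  shows "ln (2 / \<alpha>) \<ge> ln (5/4)"
    and "\<alpha> \<ge> x powr (-1/4) \<Longrightarrow>
      real (card (A + A)) \<ge> c\<^sub>1 / (180 * (ln (2 * M ^ 3) / ln (5/4) + 3)) * (ln x / ln (2 / \<alpha>)) * card A"
proof -
  define n where "n = nat \<lfloor>x\<rfloor>"
  have n: "real n \<le> x" "x - 1 \<le> real n" using x(1) by (auto simp: n_def)
  have lnx: "ln x \<ge> 1"
    using x(1) exp_le by (simp add: ln_ge_iff)
  have An: "A \<subseteq> primes_upto n"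
    using A(1) by (auto simp: primes_upto_def n_def le_nat_floor)
  have finA: "finite A" using An finite_primes_upto by (rule finite_subset)
  have cA: "card A > 0" using finA A(2) by (simp add: card_gt_0_iff)
  have cA': "real (card A) = \<alpha> * (x / ln x)" using \<alpha> by (simp add: field_simps)
  have xl: "x / ln x > 0" using x(1) lnx by simp
  have \<alpha>0: "\<alpha> > 0"
    using cA cA' xl by (metis of_nat_0_less_iff zero_less_mult_pos2)
  have \<alpha>1: "\<alpha> \<le> 8/5"
  proof -
    have "real (card A) \<le> x powr (9/10) + real n * ln 4 / ln (x powr (9/10))"
      using An x(1) by (intro card_primes_le) (auto intro!: gr_one_powr)
    also have "real n * ln 4 / ln (x powr (9/10)) \<le> x * (25/18) / (9/10 * ln x)"
    proof -
      have "ln (4::real) = 2 * ln 2" using ln_realpow[of 2 2] by simp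
      hence "ln (4::real) \<le> 25/18" using ln2_le_25_over_36 by simp
      hence "real n * ln 4 \<le> x * (25/18)" using n x(1) by (intro mult_mono) auto
      moreover have "ln (x powr (9/10)) = 9/10 * ln x" using x(1) by (simp add: ln_powr)
      ultimately show ?thesis using lnx by (simp only:) (rule divide_right_mono, auto)
    qed
    also note x(2)
    finally have "\<alpha> * (x / ln x) \<le> 8/5 * (x / ln x)" using cA' by simp
    thus ?thesis using xl by (simp only: mult_le_cancel_right_pos)
  qed
  define u where "u = 2 / \<alpha>"
  have u: "u \<ge> 5/4" using \<alpha>0 \<alpha>1 by (simp add: u_def field_simps)
  show 1: "ln (2 / \<alpha>) \<ge> ln (5/4)" using u by (simp add: u_def[symmetric])
  assume al: "\<alpha> \<ge> x powr (-1/4)"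
  have c1: "c\<^sub>1 > 0" by (simp add: c\<^sub>1_def)
  have M: "M \<ge> 5" "M * c\<^sub>1 \<ge> 138240" using c1 by (auto simp: M_def distrib_right)
  \<comment> \<open>The cube makes the square root of z, even after division by ln z, exceed a
    multiple of 1 / \<alpha>; this is what \<open>main\<close> requires. At the same time ln z stays
    of order ln (2 / \<alpha>).\<close>
  define z where "z = nat \<lceil>(M * u) ^ 3\<rceil>"
  have Mu: "M * u \<ge> 25/4" using mult_mono[of 5 M "5/4" u] M u by simp
  have Mu3: "(M * u) ^ 3 \<ge> 200" using power_mono[OF Mu, of 3] by (simp add: power3_eq_cube)
  have z: "real z \<ge> (M * u) ^ 3" "real z \<le> 2 * (M * u) ^ 3"
    using Mu3 by (auto simp: z_def) linarith+
  have z96: "z \<ge> 96" using z(1) Mu3 by linarith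
  have lnz: "ln (real z) > 0" using z96 by simp
  define R where "R = nat \<lfloor>x powr (1/26)\<rfloor>"
  have R: "real R \<le> x powr (1/26)" "x powr (1/26) - 1 \<le> real R" "R > 0"
    using x(3) by (auto simp: R_def)
  have Rpow: "real R ^ k \<le> x powr (k / 26)" for k
  proof -
    have "real R ^ k \<le> (x powr (1/26)) ^ k" using R by (intro power_mono) auto
    also have "\<dots> = x powr (k / 26)" using x(1) by (simp add: powr_realpow[symmetric] powr_powr)
    finally show ?thesis .
  qed
  have lnR: "ln (real R) \<ge> ln x / 30"
  proof -
    have "ln (x powr (1/26) - 1) \<le> ln (real R)" using R x(3) by (intro ln_mono) auto
    thus ?thesis using x(4) by linarith
  qed
  have R8: "3 * R ^ 8 \<le> n"
  proof -
    have "3 * real R ^ 8 \<le> 3 * x powr (8/26)" using Rpow[of 8] by simp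
    also have "\<dots> \<le> real n" using x(5) n by linarith
    finally have "real (3 * R ^ 8) \<le> real n" by simp
    thus ?thesis by (simp only: of_nat_le_iff)
  qed
  have R12: "8 * real R ^ 12 \<le> card A"
  proof -
    have "8 * real R ^ 12 \<le> x powr (3/4) / ln x" using Rpow[of 12] x(6) by simp
    also have "x powr (3/4) = x powr (-1/4) * x" using x(1) powr_add[of x "-1/4" 1] by simp
    also have "\<dots> / ln x \<le> \<alpha> * x / ln x"
      using al lnx x(1) by (intro divide_right_mono mult_right_mono) auto
    finally show ?thesis using cA' by simp
  qed
  \<comment> \<open>Sieving primes are at most \<open>R\<close>, so a prime above \<open>R\<close>
    is divisible by none of them.\<close>
  define A' where "A' = {a\<in>A. R < a}"
  have A'A: "A' \<subseteq> A" by (auto simp: A'_def)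
  have cA'2: "2 * real (card A') \<ge> card A"
  proof -
    have "card (A - A') \<le> card {1..R}"
      using An by (intro card_mono) (auto simp: A'_def primes_upto_def Suc_le_eq prime_gt_0_nat)
    hence "real (card A) - card A' \<le> R"
      using finA A'A by (simp add: card_Diff_subset finite_subset)
    moreover have "R \<le> R ^ 12" using R by (intro self_le_power) auto
    hence "real R \<le> real R ^ 12" by (metis of_nat_le_iff of_nat_power)
    ultimately show ?thesis using R12 by linarith
  qed
  define P where "P = {p\<in>primes_upto R. z \<le> p}"
  define G where "G = sieve_mass P R"
  have P: "finite P" "\<forall>p\<in>P. prime p" "\<forall>p\<in>P. z \<le> p" by (auto simp: P_def primes_upto_def)
  have G1: "G \<ge> 1" using P R by (auto simp: G_def intro!: sieve_mass_ge_1)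
  have G: "G \<ge> c\<^sub>1 * (ln x / 30) / ln (real z)"
  proof -
    have "c\<^sub>1 * (ln x / 30) / ln (real z) \<le> c\<^sub>1 * ln (real R) / ln (real z)"
      using lnR c1 lnz by (intro divide_right_mono mult_left_mono) auto
    also have "\<dots> = c\<^sub>1 * (ln (real R) / ln (real z))" by simp
    also have "\<dots> \<le> G"
      unfolding G_def P_def c\<^sub>1_def using R z96 by (intro sieve_mass_lower_bound) auto
    finally show ?thesis .
  qed
  have main: "2304 * (real n)\<^sup>2 \<le> real z * (G * card A')\<^sup>2"
  proof -
    \<comment> \<open>With z = y^6 one has ln z \<le> 6 y. Dividing the square root y^3 of z by this
      leaves a multiple of y^2, which is at least M u and so cancels the factor \<alpha> of
      |A|.\<close>
    define y where "y = real z powr (1/6)"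
    have y: "y > 0" using z96 by (simp add: y_def)
    have y6: "y ^ 6 = real z" using z96 by (simp add: y_def powr_realpow[symmetric] powr_powr)
    have "ln (real z) = 6 * ln y" using z96 by (simp add: y_def ln_powr)
    hence lny: "ln (real z) \<le> 6 * y" using ln_le_minus_one[OF y] by simp
    have "(y\<^sup>2) ^ 3 \<ge> (M * u) ^ 3" using z(1) y6 by simp
    hence yMu: "y\<^sup>2 \<ge> M * u" using power_le_imp_le_base[of "M * u" 2 "y\<^sup>2"] by (simp add: numeral_eq_Suc)
    have "48 * real n \<le> y ^ 3 * (G * card A')"
    proof -
      have "c\<^sub>1 * (ln x / 30) / (6 * y) \<le> c\<^sub>1 * (ln x / 30) / ln (real z)"
        using lny lnz y c1 lnx by (intro divide_left_mono mult_nonneg_nonneg mult_pos_pos) auto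
      also have "\<dots> \<le> G" by (rule G)
      finally have Gy: "c\<^sub>1 * (ln x / 30) / (6 * y) \<le> G" .
      \<comment> \<open>The number 138240 in \<open>M\<close> is 2880 * 48, and 48 is the square
        root of 2304.\<close>
      have "2880 * 48 \<le> M * c\<^sub>1" using M by simp
      hence "48 * x \<le> M * c\<^sub>1 * x / 2880" using x(1) by (simp add: field_simps)
      also have "\<dots> = (M * u) * (c\<^sub>1 * (x * \<alpha>) / 5760)"
        using \<alpha>0 by (simp add: u_def)
      also have "\<dots> \<le> y\<^sup>2 * (c\<^sub>1 * (x * \<alpha>) / 360)"
        using yMu c1 x(1) \<alpha>0 M u by (intro mult_mono) (auto simp: field_simps)
      also have "\<dots> = y ^ 3 * (c\<^sub>1 * (ln x / 30) / (6 * y) * (card A / 2))"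
        using y lnx cA' by (simp add: field_simps power2_eq_square power3_eq_cube)
      also have "\<dots> \<le> y ^ 3 * (G * card A')"
        using Gy cA'2 y G1 by (intro mult_left_mono mult_mono) auto
      finally show ?thesis using n by linarith
    qed
    hence "(48 * real n)\<^sup>2 \<le> (y ^ 3 * (G * card A'))\<^sup>2" by (intro power_mono) auto
    also have "\<dots> = y ^ 6 * (G * card A')\<^sup>2"
      by (simp add: power_mult_distrib flip: power_mult)
    finally show ?thesis by (simp add: y6 power_mult_distrib)
  qed
  have "card (A' + A') \<ge> card A' * G / 3"
    unfolding G_def
  proof (rule sumset_rough_lower_bound[OF P z96 R(3) R8])
    show "A' \<subseteq> {..n}" using An by (auto simp: A'_def primes_upto_def)
    show "\<not> p dvd a" if "a \<in> A'" "p \<in> P" for a p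
      using that An primes_dvd_imp_eq[of p a] by (auto simp: A'_def P_def primes_upto_def)
    have "real (4 * R ^ 12) \<le> real (card A')" using R12 cA'2 by simp
    thus "4 * R ^ 12 \<le> card A'" by (simp only: of_nat_le_iff)
    show "2304 * (real n)\<^sup>2 \<le> real z * (sieve_mass P R * card A')\<^sup>2"
      using main by (simp add: G_def)
  qed
  moreover have "card (A' + A') \<le> card (A + A)"
    using finA A'A by (intro card_mono finite_set_plus set_plus_mono2)
  moreover have "card A' * G / 3 \<ge> c\<^sub>1 / (180 * (ln (2 * M ^ 3) / ln (5/4) + 3)) * (ln x / ln (2 / \<alpha>)) * card A"
  proof -
    define C where "C = ln (2 * M ^ 3) / ln (5/4) + 3"
    have "M ^ 3 \<ge> 1" using M by (intro one_le_power) simp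
    hence lnM: "ln (2 * M ^ 3) \<ge> 0" by simp
    have lnu: "ln u > 0" using u by simp
    have C: "C > 0" using lnM by (simp add: C_def add_nonneg_pos)
    \<comment> \<open>Since ln u \<ge> ln (5/4), the constant ln (2 M^3) is at most a fixed multiple
      of ln u.\<close>
    have "ln (real z) \<le> ln (2 * M ^ 3 * u ^ 3)" using z z96 by (intro ln_mono) (auto simp: power_mult_distrib)
    also have "\<dots> = ln (2 * M ^ 3) + 3 * ln u"
      using M u by (subst ln_mult_pos) (auto simp: ln_realpow)
    also have "ln (2 * M ^ 3) \<le> ln (2 * M ^ 3) / ln (5/4) * ln u"
      using lnM 1 mult_left_mono[of "ln (5/4)" "ln u" "ln (2 * M ^ 3)"] by (simp add: u_def field_simps)
    finally have "ln (real z) \<le> C * ln u" by (simp add: C_def distrib_right)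
    hence "c\<^sub>1 * (ln x / 30) / (C * ln u) \<le> c\<^sub>1 * (ln x / 30) / ln (real z)"
      using c1 lnx lnz by (intro divide_left_mono) (auto intro!: mult_pos_pos C lnu)
    also note G
    finally have "(card A / 2) * (c\<^sub>1 * (ln x / 30) / (C * ln u)) \<le> card A' * G"
      using cA'2 c1 lnx C lnu by (intro mult_mono) auto
    thus ?thesis unfolding C_def[symmetric] u_def[symmetric] by (simp add: mult_ac)
  qed
  ultimately show "real (card (A + A)) \<ge>
      c\<^sub>1 / (180 * (ln (2 * M ^ 3) / ln (5/4) + 3)) * (ln x / ln (2 / \<alpha>)) * card A" by linarith
qed

theorem theorem1p2:
  shows "\<exists>(c'::real) (x\<^sub>0::real). c' > 0 \<and>
    (\<forall>(x::real) (A::nat set) (\<alpha>::real).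
       x \<ge> x\<^sub>0 \<longrightarrow> A \<noteq> {} \<longrightarrow> (\<forall>p\<in>A. prime p \<and> 1 \<le> real p \<and> real p \<le> x) \<longrightarrow>
       real (card A) = \<alpha> * x * inverse (ln x) \<longrightarrow>
       real (card (A + A)) \<ge> c' * (ln x / ln (2 * inverse \<alpha>)) * real (card A))"
proof -
  define c\<^sub>1 :: real where "c\<^sub>1 = ln 2 / (2 * exp 3)"
  define M where "M = 5 + 138240 / c\<^sub>1"
  define c\<^sub>2 where "c\<^sub>2 = c\<^sub>1 / (180 * (ln (2 * M ^ 3) / ln (5/4) + 3))"
  have c1: "c\<^sub>1 > 0" by (simp add: c\<^sub>1_def)
  hence "M ^ 3 \<ge> 1" by (intro one_le_power) (simp add: M_def)
  hence "ln (2 * M ^ 3) \<ge> 0" by simp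
  hence c2: "c\<^sub>2 > 0" using c1 by (simp add: c\<^sub>2_def add_nonneg_pos)
  obtain x\<^sub>0 where x0: "\<And>x :: real. x \<ge> x\<^sub>0 \<Longrightarrow>
     x \<ge> 3 \<and> x powr (9/10) + x * (25/18) / (9/10 * ln x) \<le> 8/5 * (x / ln x) \<and>
     x powr (1/26) \<ge> 2 \<and> ln (x powr (1/26) - 1) \<ge> ln x / 30 \<and> 3 * x powr (8/26) \<le> x - 1 \<and>
     8 * x powr (12/26) \<le> x powr (3/4) / ln x"
    using eventually_numeric_conditions unfolding eventually_at_top_linorder by blast
  show ?thesis
  \<comment> \<open>The sieve gives \<open>c\<^sub>2\<close> when \<alpha> \<ge> x^(-1/4), and 1/4
    serves the sparse sets.\<close>
  proof (rule exI[of _ "min (1/4) c\<^sub>2"], rule exI[of _ x\<^sub>0], intro conjI allI impI)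
    show "0 < min (1/4) c\<^sub>2" using c2 by simp
    fix x \<alpha> :: real and A :: "nat set"
    assume x: "x\<^sub>0 \<le> x" and A: "A \<noteq> {}" "\<forall>p\<in>A. prime p \<and> 1 \<le> real p \<and> real p \<le> x"
      and \<alpha>: "real (card A) = \<alpha> * x * inverse (ln x)"
    note aux = sumset_primes_lower_bound[of x A \<alpha>, folded c\<^sub>1_def, folded M_def, folded c\<^sub>2_def]
    have lnu: "ln (2 / \<alpha>) > 0"
    proof -
      have "ln (5/4) \<le> ln (2 / \<alpha>)"
        by (rule aux(1)) (use x0[OF x] A \<alpha> in blast)+
      thus ?thesis using ln_gt_zero[of "5/4 :: real"] by linarith
    qed
    have x3: "x \<ge> 3" using x0[OF x] by simp
    have finA: "finite A"
      by (rule finite_subset[of _ "{..nat \<lfloor>x\<rfloor>}"]) (use A in \<open>auto simp: le_nat_floor\<close>)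
    let ?q = "ln x / ln (2 / \<alpha>)"
    have q: "?q \<ge> 0" using lnu x3 by simp
    have "min (1/4) c\<^sub>2 * ?q * card A \<le> card (A + A)"
    proof (cases "\<alpha> \<ge> x powr (-1/4)")
      case True
      have "min (1/4) c\<^sub>2 * ?q * card A \<le> c\<^sub>2 * ?q * card A"
        using q by (intro mult_right_mono) auto
      also have "\<dots> \<le> card (A + A)"
        by (rule aux(2)) (use x0[OF x] A \<alpha> True in blast)+
      finally show ?thesis .
    next
      \<comment> \<open>Here ln (2 / \<alpha>) is at least ln x / 4, so the quotient of logarithms
        is at most 4 and the trivial bound |A + A| \<ge> |A|, from a single translate of
        \<open>A\<close>, is enough.\<close>
      case False
      have "\<alpha> > 0"
      proof (rule ccontr)
        assume "\<not> \<alpha> > 0"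
        hence "\<alpha> * (x * inverse (ln x)) \<le> 0" using x3 by (intro mult_nonpos_nonneg) auto
        moreover have "card A > 0" using finA A by (simp add: card_gt_0_iff)
        ultimately show False using \<alpha> by (simp add: mult.assoc)
      qed
      hence "ln \<alpha> \<le> ln (x powr (-1/4))" using False by (intro ln_mono) auto
      moreover have "ln (x powr (-1/4)) = - ln x / 4" "ln (2 / \<alpha>) = ln 2 - ln \<alpha>" "ln (2 :: real) > 0"
        using x3 \<open>\<alpha> > 0\<close> by (simp_all add: ln_powr ln_div)
      ultimately have "ln x / 4 \<le> ln (2 / \<alpha>)" by linarith
      hence "?q \<le> 4" using lnu by (simp add: field_simps)
      hence "min (1/4) c\<^sub>2 * ?q * card A \<le> 1/4 * 4 * card A"
        using q by (intro mult_right_mono mult_mono) (use c2 in auto)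
      also have "\<dots> \<le> card (A + A)"
      proof -
        obtain a where a: "a \<in> A" using A by auto
        have "card ((\<lambda>b. a + b) ` A) \<le> card (A + A)"
          using a finA by (intro card_mono finite_set_plus) (auto simp: set_plus_def)
        thus ?thesis by (simp add: card_image)
      qed
      finally show ?thesis .
    qed
    moreover have "2 / \<alpha> = 2 * inverse \<alpha>" by (rule divide_inverse)
    ultimately show "min (1/4) c\<^sub>2 * (ln x / ln (2 * inverse \<alpha>)) * real (card A) \<le> real (card (A + A))"
      by (simp only:)
  qed
qed

end
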